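(* There exists a transitive dynamical system $(X,T)$ with the shadowing property such that $h_\mu(T)<h_{\mathrm{top}}(T)$ for every $T$-invariant Borel probability measure $\mu$ on $X$.
   Context: A dynamical system $(X,T)$ is a compact metric space $(X,d)$ with a continuous map $T\colon X\to X$. It is transitive if for any two nonempty open sets $U,V\subset X$ there is $n>0$ with $T^n(U)\cap V\neq\emptyset$. A sequence $(x_n)_{n=0}^\infty$ in $X$ is a $\delta$-pseudo-orbit if $d(T(x_n),x_{n+1})<\delta$ for all $n\ge 0$; it is $\varepsilon$-traced by $y\in X$ if $d(T^n(y),x_n)<\varepsilon$ for all $n\ge 0$. $(X,T)$ has the shadowing property if for every $\varepsilon>0$ there is $\delta>0$ such that every $\delta$-pseudo-orbit is $\varepsilon$-traced by some point of $X$. $h_\mu(T)$ is the measure-theoretic entropy of $\mu$ and $h_{\mathrm{top}}(T)$ the topological entropy of $(X,T)$. *)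

theory Defs
  imports "HOL-Probability.Probability"
begin

text \<open>
  A system consists of an abstract metric space \<open>m\<close> and a map \<open>T\<close>; only the values of \<open>T\<close> on
  \<open>mspace m\<close> matter. The type of abstract metric spaces admits the empty space, which is
  excluded here: it would satisfy every condition on points, open sets and measures vacuously.
\<close>

definition dynamical_system :: "'a metric \<Rightarrow> ('a \<Rightarrow> 'a) \<Rightarrow> bool" where
  "dynamical_system m T \<longleftrightarrow>
     mspace m \<noteq> {} \<and> compact_space (mtopology_of m) \<and>
     continuous_map (mtopology_of m) (mtopology_of m) T"

definition transitive_system :: "'a metric \<Rightarrow> ('a \<Rightarrow> 'a) \<Rightarrow> bool" where
  "transitive_system m T \<longleftrightarrow>
     (\<forall>U V. openin (mtopology_of m) U \<and> U \<noteq> {} \<and> openin (mtopology_of m) V \<and> V \<noteq> {} \<longrightarrow>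
        (\<exists>n>0. (T ^^ n) ` U \<inter> V \<noteq> {}))"

definition pseudo_orbit :: "'a metric \<Rightarrow> ('a \<Rightarrow> 'a) \<Rightarrow> real \<Rightarrow> (nat \<Rightarrow> 'a) \<Rightarrow> bool" where
  "pseudo_orbit m T \<delta> x \<longleftrightarrow> range x \<subseteq> mspace m \<and> (\<forall>n. mdist m (T (x n)) (x (Suc n)) < \<delta>)"

definition traces :: "'a metric \<Rightarrow> ('a \<Rightarrow> 'a) \<Rightarrow> real \<Rightarrow> 'a \<Rightarrow> (nat \<Rightarrow> 'a) \<Rightarrow> bool" where
  "traces m T \<epsilon> y x \<longleftrightarrow> (\<forall>n. mdist m ((T ^^ n) y) (x n) < \<epsilon>)"

definition shadowing_property :: "'a metric \<Rightarrow> ('a \<Rightarrow> 'a) \<Rightarrow> bool" where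
  "shadowing_property m T \<longleftrightarrow>
     (\<forall>\<epsilon>>0. \<exists>\<delta>>0. \<forall>x. pseudo_orbit m T \<delta> x \<longrightarrow> (\<exists>y\<in>mspace m. traces m T \<epsilon> y x))"

subsection \<open>Topological entropy\<close>

definition dyn_separated :: "'a metric \<Rightarrow> ('a \<Rightarrow> 'a) \<Rightarrow> nat \<Rightarrow> real \<Rightarrow> 'a set \<Rightarrow> bool" where
  "dyn_separated m T n \<epsilon> E \<longleftrightarrow>
     E \<subseteq> mspace m \<and>
     (\<forall>x\<in>E. \<forall>y\<in>E. x \<noteq> y \<longrightarrow> (\<exists>i<n. mdist m ((T ^^ i) x) ((T ^^ i) y) > \<epsilon>))"

text \<open>
  Bowen's definition. The inner supremum is \<open>(1/n) * ln s\<close>, where \<open>s\<close> is the maximal cardinality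
  of an \<open>(n, \<epsilon>)\<close>-separated set. The outer supremum is the limit as \<open>\<epsilon>\<close> tends to \<open>0\<close>, since the
  upper growth rate is antitone in \<open>\<epsilon>\<close>. The value may be \<open>\<infinity>\<close>.
\<close>

definition top_entropy :: "'a metric \<Rightarrow> ('a \<Rightarrow> 'a) \<Rightarrow> ereal" where
  "top_entropy m T =
     (SUP \<epsilon>\<in>{0<..}. limsup (\<lambda>n. SUP E\<in>{E. finite E \<and> dyn_separated m T n \<epsilon> E}.
        ereal (ln (real (card E)) / real n)))"

subsection \<open>Invariant measures and measure-theoretic entropy\<close>

definition borel_prob_on :: "'a metric \<Rightarrow> 'a measure \<Rightarrow> bool" where
  "borel_prob_on m \<mu> \<longleftrightarrow>
     prob_space \<mu> \<and> space \<mu> = mspace m \<and>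
     sets \<mu> = sigma_sets (mspace m) {U. openin (mtopology_of m) U}"

definition invariant_measure :: "('a \<Rightarrow> 'a) \<Rightarrow> 'a measure \<Rightarrow> bool" where
  "invariant_measure T \<mu> \<longleftrightarrow>
     T \<in> measurable \<mu> \<mu> \<and> (\<forall>A\<in>sets \<mu>. measure \<mu> (T -` A \<inter> space \<mu>) = measure \<mu> A)"

definition finite_meas_partition :: "'a measure \<Rightarrow> 'a set set \<Rightarrow> bool" where
  "finite_meas_partition \<mu> P \<longleftrightarrow> finite P \<and> P \<subseteq> sets \<mu> \<and> partition_on (space \<mu>) P"

definition partition_join :: "'a set set \<Rightarrow> 'a set set \<Rightarrow> 'a set set" where
  "partition_join P Q = {A \<inter> B |A B. A \<in> P \<and> B \<in> Q} - {{}}"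

definition partition_pullback :: "'a set \<Rightarrow> ('a \<Rightarrow> 'a) \<Rightarrow> 'a set set \<Rightarrow> 'a set set" where
  "partition_pullback X S P = (\<lambda>A. S -` A \<inter> X) ` P - {{}}"

text \<open>The join of the pullbacks of \<open>P\<close> under \<open>T ^^ i\<close> for \<open>i < n\<close>.\<close>

primrec iterated_join :: "'a set \<Rightarrow> ('a \<Rightarrow> 'a) \<Rightarrow> 'a set set \<Rightarrow> nat \<Rightarrow> 'a set set" where
  "iterated_join X T P 0 = {X}"
| "iterated_join X T P (Suc n) =
     partition_join (iterated_join X T P n) (partition_pullback X (T ^^ n) P)"

definition partition_entropy :: "'a measure \<Rightarrow> 'a set set \<Rightarrow> real" where
  "partition_entropy \<mu> P = - (\<Sum>A\<in>P. measure \<mu> A * ln (measure \<mu> A))"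

text \<open>
  For an invariant measure the sequence below converges by subadditivity, so that \<open>limsup\<close> is
  the usual limit.
\<close>

definition entropy_wrt :: "'a measure \<Rightarrow> ('a \<Rightarrow> 'a) \<Rightarrow> 'a set set \<Rightarrow> ereal" where
  "entropy_wrt \<mu> T P =
     limsup (\<lambda>n. ereal (partition_entropy \<mu> (iterated_join (space \<mu>) T P n) / real n))"

definition measure_entropy :: "'a measure \<Rightarrow> ('a \<Rightarrow> 'a) \<Rightarrow> ereal" where
  "measure_entropy \<mu> T = (SUP P\<in>{P. finite_meas_partition \<mu> P}. entropy_wrt \<mu> T P)"

end

theory Submission
  imports Defs "HOL-Library.Nat_Bijection"
begin

text \<open>
  The system consists of the walks on a countable graph: a hub \<open>0\<close> with an edge to itself and, for
  every \<open>k \<ge> 2\<close>, \<open>4 ^ (k\<^sup>2 - k)\<close> disjoint loops of length \<open>k\<^sup>2\<close> through the hub. The states are compactified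
  so that long loops accumulate at the hub. Collapsing all loops with \<open>k \<ge> m\<close> to the hub is a graph
  homomorphism onto a finite subgraph that moves points little; it turns pseudo-orbits into
  genuine walks, which gives shadowing.

  The loops of length \<open>k\<^sup>2\<close> alone produce entropy \<open>(1 - 1/k) ln 4\<close>, so the topological entropy
  is at least \<open>ln 4\<close>. On the other hand, the loop generating function at \<open>1/4\<close> is
  \<open>1/4 + (\<Sum>k\<ge>2. 4 ^ (- k)) = 1/3 < 1/2\<close>: the graph is transient. Words can therefore be
  weighted by a factor \<open>1/4\<close> per step and even \<open>1/2\<close> per visit to the hub with bounded total mass.
  Gibbs' inequality then bounds the entropy of an invariant measure \<open>\<mu>\<close> by
  \<open>ln 4 - ln 2 * \<mu>(hub)\<close>, and \<open>\<mu>(hub) > 0\<close> because every walk visits the hub.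
\<close>

subsection \<open>Walks on the loop graph\<close>

text \<open>The state on loop \<open>c\<close> of length \<open>k\<^sup>2\<close> from which the hub is reached in \<open>j\<close> steps; \<open>j = 0\<close> is
  the hub itself, for all \<open>k\<close> and \<open>c\<close>.\<close>

definition node :: "nat \<Rightarrow> nat \<Rightarrow> nat \<Rightarrow> nat" where
  "node k c j = (if j = 0 then 0 else Suc (prod_encode (k, prod_encode (c, j))))"

definition steps :: "nat \<Rightarrow> nat" where
  "steps a = (if a = 0 then 0 else snd (prod_decode (snd (prod_decode (a - 1)))))"

definition states :: "nat \<Rightarrow> nat set" where
  "states m = insert 0 {node k c j |k c j. 2 \<le> k \<and> k < m \<and> c < 4 ^ (k * k - k) \<and> j < k * k}"

text \<open>The loop with label \<open>c\<close> is one \<open>enter\<close> edge followed by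
  \<open>k * k - 1\<close> edges of kind \<open>step\<close>. The last of these has
  \<open>j = 0\<close> and ends at the hub, because \<open>node k c 0\<close> is the hub.\<close>

inductive edge :: "nat \<Rightarrow> nat \<Rightarrow> bool" where
  stay: "edge 0 0"
| enter: "2 \<le> k \<Longrightarrow> c < 4 ^ (k * k - k) \<Longrightarrow> edge 0 (node k c (k * k - 1))"
| step: "2 \<le> k \<Longrightarrow> c < 4 ^ (k * k - k) \<Longrightarrow> Suc j < k * k \<Longrightarrow> edge (node k c (Suc j)) (node k c j)"

definition trunc :: "nat \<Rightarrow> nat \<Rightarrow> nat" where
  "trunc m a = (if a \<in> states m then a else 0)"

definition walk :: "(nat \<Rightarrow> nat) \<Rightarrow> bool" where
  "walk x \<longleftrightarrow> (\<forall>i. edge (x i) (x (Suc i)))"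

lemma node_0 [simp]: "node k c 0 = 0"
  by (simp add: node_def)

lemma node_eq_0_iff [simp]: "node k c j = 0 \<longleftrightarrow> j = 0"
  by (simp add: node_def)

lemma node_inject: "node k c j = node k' c' j' \<longleftrightarrow> j = 0 \<and> j' = 0 \<or> k = k' \<and> c = c' \<and> j = j' \<and> j \<noteq> 0"
  by (auto simp: node_def)

lemma steps_node [simp]: "steps (node k c j) = j"
  by (auto simp: node_def steps_def)

lemma steps_0 [simp]: "steps 0 = 0"
  by (simp add: steps_def)

text \<open>Nodes on loops with large \<open>k\<close> have large numbers. Their reciprocals are
  therefore close to 0, the image of the hub, which is how long loops come to accumulate
  there.\<close>

lemma less_node: "j \<noteq> 0 \<Longrightarrow> k < node k c j"
  by (simp add: node_def le_prod_encode_1 less_Suc_eq_le)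

lemma zero_in_states [simp]: "0 \<in> states m"
  by (simp add: states_def)

lemma node_in_states:
  assumes "2 \<le> k" "c < 4 ^ (k * k - k)" "j < k * k"
  shows "node k c j \<in> states m \<longleftrightarrow> j = 0 \<or> k < m"
  using assms by (fastforce simp: states_def node_inject)

lemma statesE:
  assumes "a \<in> states m"
  obtains k c j where "a = node k c j" "2 \<le> k" "c < 4 ^ (k * k - k)" "j < k * k" "a \<noteq> 0 \<Longrightarrow> k < m"
proof (cases "a = 0")
  case True
  then show ?thesis by (intro that[of 2 0 0]) auto
next
  case False
  then show ?thesis using assms that by (auto simp: states_def)
qed

lemma finite_states [simp]: "finite (states m)"
proof -
  let ?f = "\<lambda>(k, c, j). node k c j"
  let ?D = "SIGMA k : {..<m}. {..<4 ^ (k * k - k) :: nat} \<times> {..<k * k}"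
  have "a \<in> insert 0 (?f ` ?D)" if "a \<in> states m" for a
  proof (cases "a = 0")
    case False
    from that obtain k c j where "a = node k c j" "c < 4 ^ (k * k - k)" "j < k * k" "k < m"
      using False by (elim statesE) auto
    then have "a = ?f (k, c, j)" "(k, c, j) \<in> ?D" by auto
    then show ?thesis by blast
  qed simp
  then have "states m \<subseteq> insert 0 (?f ` ?D)" by blast
  moreover have "finite ?D" by (intro finite_SigmaI finite_cartesian_product) auto
  ultimately show ?thesis by (meson finite_imageI finite_insert finite_subset)
qed

lemma states_mono: "m \<le> n \<Longrightarrow> states m \<subseteq> states n"
  unfolding states_def by fastforce

lemma steps_less: "a \<in> states m \<Longrightarrow> steps a < m * m + 1"
proof (erule statesE)
  fix k c j assume a: "a = node k c j" "j < k * k" "a \<noteq> 0 \<Longrightarrow> k < m"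
  have "a \<noteq> 0 \<Longrightarrow> k * k \<le> m * m" using a(3) by (intro mult_mono) auto
  then show ?thesis using a by (cases "j = 0") auto
qed

lemma trunc_in_states [simp]: "trunc m a \<in> states m"
  by (simp add: trunc_def)

lemma trunc_0 [simp]: "trunc m 0 = 0"
  by (simp add: trunc_def)

lemma trunc_trunc: "m \<le> n \<Longrightarrow> trunc m (trunc n a) = trunc m a"
  using states_mono[of m n] by (auto simp: trunc_def)

lemma edge_states:
  assumes "edge a b"
  obtains m where "a \<in> states m" "b \<in> states m"
  using assms
proof cases
  case (enter k c)
  then show ?thesis using that[of "Suc k"] by (simp add: node_in_states)
next
  case (step k c j)
  then show ?thesis using that[of "Suc k"] by (simp add: node_in_states)
qed auto

text \<open>The inner nodes of one loop lie either all inside or all outside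
  \<open>states m\<close>. An edge of a kept loop is fixed, and an edge of a collapsed loop becomes
  the edge from the hub to itself.\<close>

lemma edge_trunc:
  assumes "edge a b"
  shows "edge (trunc m a) (trunc m b)"
  using assms
proof cases
  case (enter k c)
  then have "node k c (k * k - 1) \<in> states m \<longleftrightarrow> k * k - 1 = 0 \<or> k < m"
    by (intro node_in_states) auto
  then show ?thesis using enter edge.enter[of k c] edge.stay by (auto simp: trunc_def)
next
  case (step k c j)
  then have "node k c j \<in> states m \<longleftrightarrow> j = 0 \<or> k < m" "node k c (Suc j) \<in> states m \<longleftrightarrow> k < m"
    by (auto simp: node_in_states)
  then show ?thesis using step edge.step[of k c j] edge.stay by (auto simp: trunc_def)
qed (simp add: edge.stay)

lemma walk_trunc: "walk x \<Longrightarrow> walk (\<lambda>i. trunc m (x i))"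
  by (simp add: walk_def edge_trunc)

lemma walk_states:
  assumes "walk x" obtains m where "x i \<in> states m"
  using assms edge_states unfolding walk_def by metis

lemma walk_shift: "walk x \<Longrightarrow> walk (\<lambda>i. x (i + n))"
  by (simp add: walk_def)

lemma walk_const_0: "walk (\<lambda>i. 0)"
  by (simp add: walk_def edge.stay)

lemma walk_append:
  assumes "walk x" "walk z" "x n = z 0"
  shows "walk (\<lambda>i. if i < n then x i else z (i - n))"
  unfolding walk_def
proof
  fix i
  consider "Suc i < n" | "Suc i = n" | "n \<le> i" by linarith
  then show "edge (if i < n then x i else z (i - n))
      (if Suc i < n then x (Suc i) else z (Suc i - n))"
  proof cases
    case 2
    then show ?thesis using assms(1,3) by (auto simp: walk_def dest: spec[of _ i])
  qed (use assms in \<open>auto simp: walk_def Suc_diff_le\<close>)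
qed

lemma edge_step_node:
  "edge a b \<Longrightarrow> a \<noteq> 0 \<Longrightarrow> \<exists>k c j. a = node k c (Suc j) \<and> b = node k c j"
  by (erule edge.cases) auto

text \<open>Off the hub every state has exactly one successor, so a walk inside a loop is forced
  until it is back at the hub.\<close>

lemma walk_countdown:
  assumes "walk x" "x 0 = node k c j" "i \<le> j"
  shows "x i = node k c (j - i)"
  using assms(3)
proof (induction i)
  case 0
  then show ?case using assms by simp
next
  case (Suc i)
  then have xi: "x i = node k c (j - i)" by simp
  moreover have "edge (x i) (x (Suc i))" using assms(1) by (simp add: walk_def)
  moreover have "x i \<noteq> 0" using xi Suc by simp
  ultimately obtain k' c' j' where "x i = node k' c' (Suc j')" "x (Suc i) = node k' c' j'"
    using edge_step_node by blast
  then show ?case using xi Suc by (auto simp: node_inject)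
qed

lemma walk_hits_0:
  assumes "walk x"
  shows "\<exists>n. x n = 0"
proof -
  obtain m where "x 0 \<in> states m" using walk_states[OF assms] .
  then obtain k c j where "x 0 = node k c j" by (rule statesE)
  then have "x j = 0" using walk_countdown[OF assms, of k c j j] by simp
  then show ?thesis ..
qed

lemma walk_from_0:
  assumes "a \<in> states m"
  shows "\<exists>x n. walk x \<and> 0 < n \<and> x 0 = 0 \<and> x n = a"
proof -
  from assms obtain k c j where a: "a = node k c j" "2 \<le> k" "c < 4 ^ (k * k - k)" "j < k * k"
    by (rule statesE)
  \<comment> \<open>The walk runs once around the loop and then rests at the hub, since subtraction
    on naturals gives 0 for \<open>i > k * k\<close>. The time \<open>k * k - j\<close> is positive
    even if \<open>a\<close> is the hub: then it is a full turn.\<close>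
  define x where "x i = node k c (if i = 0 then 0 else k * k - i)" for i
  have "edge (x i) (x (Suc i))" for i
  proof (cases "i = 0")
    case True
    then show ?thesis using edge.enter[OF a(2,3)] by (simp add: x_def)
  next
    case False
    show ?thesis
    proof (cases "i < k * k")
      case True
      then have "k * k - i = Suc (k * k - Suc i)" "Suc (k * k - Suc i) < k * k" using False by auto
      then show ?thesis using edge.step[OF a(2,3), of "k * k - Suc i"] False by (simp add: x_def)
    qed (use False in \<open>simp add: x_def edge.stay\<close>)
  qed
  then have "walk x" by (simp add: walk_def)
  moreover have "x (k * k - j) = a" using a by (simp add: x_def)
  ultimately show ?thesis using a(4) by (intro exI[of _ x] exI[of _ "k * k - j"]) (auto simp: x_def)
qed

lemma walk_join:
  assumes "walk x" "walk y"
  shows "\<exists>z n. walk z \<and> 0 < n \<and> (\<forall>i<m. z i = x i) \<and> (\<forall>i. z (i + n) = y i)"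
proof -
  \<comment> \<open>Shifting by \<open>m\<close> first makes the visit to the hub happen only after
    the first \<open>m\<close> states of \<open>x\<close> have been copied. From the hub any state,
    in particular \<open>y 0\<close>, can be reached.\<close>
  obtain p where p: "x (p + m) = 0" using walk_hits_0[OF walk_shift[OF assms(1)]] by auto
  obtain l where "y 0 \<in> states l" using walk_states[OF assms(2)] .
  then obtain w q where w: "walk w" "0 < q" "w 0 = 0" "w q = y 0" using walk_from_0 by blast
  define v where "v i = (if i < q then w i else y (i - q))" for i
  have "walk v" unfolding v_def using walk_append[OF w(1) assms(2) w(4)] .
  moreover have "v 0 = 0" using w by (simp add: v_def)
  ultimately have "walk (\<lambda>i. if i < p + m then x i else v (i - (p + m)))"
    by (intro walk_append assms) (auto simp: p)
  then show ?thesis using w(2)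
    by (intro exI[of _ "\<lambda>i. if i < p + m then x i else v (i - (p + m))"] exI[of _ "q + (p + m)"])
      (auto simp: v_def)
qed

subsection \<open>The compactified path space\<close>

text \<open>A combinatorial form of closeness. On walks these equivalence relations induce the same
  uniformity as the metric, by \<open>agree_of_dist\<close> and
  \<open>dist_of_agree\<close>.\<close>

definition agree :: "nat \<Rightarrow> (nat \<Rightarrow> nat) \<Rightarrow> (nat \<Rightarrow> nat) \<Rightarrow> bool" where
  "agree m x y \<longleftrightarrow> (\<forall>i<m. trunc m (x i) = trunc m (y i))"

text \<open>The hub \<open>0\<close> is sent to \<open>1 / 0 = 0\<close>, the limit of the other reciprocals.\<close>

definition emb :: "(nat \<Rightarrow> nat) \<Rightarrow> nat \<Rightarrow> real" where
  "emb x = (\<lambda>i. 1 / real (x i))"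

definition code :: "(nat \<Rightarrow> real) \<Rightarrow> nat \<Rightarrow> nat" where
  "code y = (\<lambda>i. nat \<lfloor>1 / y i\<rfloor>)"

definition shift :: "(nat \<Rightarrow> real) \<Rightarrow> nat \<Rightarrow> real" where
  "shift y = (\<lambda>i. y (Suc i))"

definition loop_space :: "(nat \<Rightarrow> real) set" where
  "loop_space = emb ` Collect walk"

abbreviation loop_metric :: "(nat \<Rightarrow> real) metric" where
  "loop_metric \<equiv> submetric euclidean_metric loop_space"

lemma code_emb [simp]: "code (emb x) = x"
  by (simp add: code_def emb_def)

lemma emb_eq_iff [simp]: "emb x = emb y \<longleftrightarrow> x = y"
  by (metis code_emb)

lemma emb_in_loop_space [simp]: "emb x \<in> loop_space \<longleftrightarrow> walk x"
  by (auto simp: loop_space_def)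

lemma loop_spaceE:
  assumes "y \<in> loop_space" obtains x where "walk x" "y = emb x"
  using assms by (auto simp: loop_space_def)

lemma funpow_shift: "(shift ^^ n) y = (\<lambda>i. y (i + n))"
  by (induction n arbitrary: y) (simp_all add: shift_def funpow_swap1)

lemma funpow_shift_emb: "(shift ^^ n) (emb x) = emb (\<lambda>i. x (i + n))"
  by (simp add: funpow_shift emb_def)

lemma shift_emb: "shift (emb x) = emb (\<lambda>i. x (Suc i))"
  by (simp add: shift_def emb_def)

lemma shift_loop_space: "y \<in> loop_space \<Longrightarrow> shift y \<in> loop_space"
  using walk_shift[of _ 1] by (auto simp: loop_space_def shift_emb)

lemma mono_agree: "agree n x y \<Longrightarrow> m \<le> n \<Longrightarrow> agree m x y"
  unfolding agree_def by (metis trunc_trunc order_less_le_trans)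

lemma agree_refl [simp]: "agree m x x" 
  by (simp add: agree_def)

lemma agree_sym: "agree m x y \<Longrightarrow> agree m y x" 
  by (simp add: agree_def)

lemma agree_trans: "agree m x y \<Longrightarrow> agree m y z \<Longrightarrow> agree m x z" 
  by (simp add: agree_def)

text \<open>The distance on functions is a series of nonnegative terms in which coordinate
  \<open>i\<close> occurs as term number \<open>to_nat i\<close>; a single term is at most the
  sum.\<close>

lemma dist_coordinate_le:
  fixes x y :: "nat \<Rightarrow> real"
  shows "(1/2) ^ to_nat i * min (dist (x i) (y i)) 1 \<le> dist x y"
proof -
  let ?f = "\<lambda>n. (1/2) ^ n * min (dist (x (from_nat n)) (y (from_nat n))) 1"
  have "summable ?f"
    by (rule summable_comparison_test'[of "\<lambda>n. (1/2) ^ n" 0]) (auto simp: summable_geometric_iff mult_left_le)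
  then have "sum ?f {to_nat i} \<le> suminf ?f"
    by (intro sum_le_suminf) auto
  then show ?thesis by (simp add: dist_fun_def)
qed

text \<open>Among the other reciprocals the one nearest to that of \<open>a\<close> belongs to
  \<open>a + 1\<close>. For \<open>b = 0\<close> the reciprocal is read as 0, which is further
  away.\<close>

lemma reciprocal_gap:
  assumes "0 < a" "a \<noteq> b"
  shows "1 / (real a * (real a + 1)) \<le> \<bar>1 / real a - 1 / real b\<bar>"
proof (cases "b = 0")
  case True
  have "1 / (real a * (real a + 1)) \<le> 1 / (real a * 1)"
    using assms by (intro divide_left_mono mult_left_mono) auto
  then show ?thesis using True by simp
next
  case False
  have "real b \<le> \<bar>real b - real a\<bar> * (real a + 1)"
  proof (cases "a < b")
    case True
    have "real a * 1 \<le> real a * (real b - real a)" using True assms by (intro mult_left_mono) auto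
    then show ?thesis using True by (simp add: algebra_simps)
  next
    case F: False
    then have "b < a" using assms by simp
    have "1 * (real a + 1) \<le> (real a - real b) * (real a + 1)"
      using \<open>b < a\<close> by (intro mult_right_mono) auto
    moreover have "\<bar>real b - real a\<bar> = real a - real b" using \<open>b < a\<close> by simp
    moreover have "real b \<le> 1 * (real a + 1)" using \<open>b < a\<close> by simp
    ultimately show ?thesis by (metis (no_types) order_trans)
  qed
  moreover have "\<bar>1 / real a - 1 / real b\<bar> = \<bar>real b - real a\<bar> / (real a * real b)"
    using assms False by (simp add: abs_divide[symmetric] diff_frac_eq abs_mult)
  moreover have "1 / (real a * (real a + 1)) = real b / (real a * real b * (real a + 1))"
    using False by simp
  moreover have "\<bar>real b - real a\<bar> / (real a * real b)
      = \<bar>real b - real a\<bar> * (real a + 1) / (real a * real b * (real a + 1))"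
    by simp
  ultimately show ?thesis by (simp only: divide_right_mono mult_nonneg_nonneg of_nat_0_le_iff add_nonneg_nonneg zero_le_one)
qed

lemma trunc_eq_of_close:
  obtains d where "0 < d" "\<And>a b. \<bar>1 / real a - 1 / real b\<bar> < d \<Longrightarrow> trunc m a = trunc m b"
proof -
  define M where "M = Max (states m)"
  \<comment> \<open>This is at most the gap around the reciprocal of any nonzero state up to
    \<open>M\<close>. Using \<open>M + 1\<close> in place of \<open>M\<close> keeps the denominator
    positive when the hub is the only state.\<close>
  define d where "d = 1 / ((real M + 1) * (real M + 2))"
  have le: "d \<le> \<bar>1 / real a - 1 / real b\<bar>" if "a \<in> states m" "a \<noteq> 0" "a \<noteq> b" for a b
  proof -
    have "a \<le> M" unfolding M_def using that by (intro Max_ge) auto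
    then have "d \<le> 1 / (real a * (real a + 1))" unfolding d_def using that
      by (intro divide_left_mono mult_mono) auto
    also have "\<dots> \<le> \<bar>1 / real a - 1 / real b\<bar>" using that by (intro reciprocal_gap) auto
    finally show ?thesis .
  qed
  have "trunc m a = trunc m b" if "\<bar>1 / real a - 1 / real b\<bar> < d" for a b
  proof (rule ccontr)
    assume n: "trunc m a \<noteq> trunc m b"
    then consider "a \<in> states m" "a \<noteq> 0" "a \<noteq> b" | "b \<in> states m" "b \<noteq> 0" "b \<noteq> a"
      by (metis trunc_def)
    then show False using le[of a b] le[of b a] that by cases (auto simp: abs_minus_commute)
  qed
  moreover have "0 < d" by (simp add: d_def)
  ultimately show ?thesis using that by blast
qed

lemma agree_of_dist:
  obtains d where "0 < d" "\<And>x y. dist (emb x) (emb y) < d \<Longrightarrow> agree m x y"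
proof -
  obtain d where d: "0 < d" "\<And>a b. \<bar>1 / real a - 1 / real b\<bar> < d \<Longrightarrow> trunc m a = trunc m b"
    using trunc_eq_of_close by blast
  \<comment> \<open>The smallest weight \<open>(1/2) ^ to_nat i\<close> among the first
    \<open>m\<close> coordinates is at least \<open>(1/2) ^ K\<close>; the inserted 0 covers
    \<open>m = 0\<close>.\<close>
  define K where "K = Max (insert 0 (to_nat ` {..<m}))"
  define e where "e = (1/2) ^ K * min d 1"
  have "agree m x y" if "dist (emb x) (emb y) < e" for x y
    unfolding agree_def
  proof (intro allI impI)
    fix i assume "i < m"
    then have "to_nat i \<le> K" by (simp add: K_def)
    then have "(1/2) ^ K * min (dist (emb x i) (emb y i)) 1
        \<le> (1/2::real) ^ to_nat i * min (dist (emb x i) (emb y i)) 1"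
      by (intro mult_right_mono power_decreasing) auto
    also have "\<dots> < (1/2) ^ K * min d 1"
      using dist_coordinate_le[where x = "emb x" and y = "emb y" and i = i] that unfolding e_def by simp
    finally have "dist (emb x i) (emb y i) < d" using d(1) by (auto simp: min_def split: if_splits)
    then show "trunc m (x i) = trunc m (y i)" by (intro d(2)) (simp add: emb_def dist_real_def)
  qed
  moreover have "0 < e" using d(1) by (simp add: e_def)
  ultimately show ?thesis using that by blast
qed

text \<open>Two different states with the same truncation are each the hub or on a loop with
  \<open>k \<ge> m\<close>. In the latter case the number of the state exceeds \<open>m\<close>, so
  both reciprocals lie between 0 and \<open>1 / (m + 1)\<close>.\<close>

lemma trunc_eq_imp_close:
  assumes "a \<in> states p" "b \<in> states q" "trunc m a = trunc m b"
  shows "\<bar>1 / real a - 1 / real b\<bar> \<le> 1 / (real m + 1)"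
proof (cases "a = b")
  case False
  have less: "a \<noteq> 0 \<Longrightarrow> a \<notin> states m \<Longrightarrow> m < a" if "a \<in> states r" for a r
  proof -
    assume a: "a \<noteq> 0" "a \<notin> states m"
    from that obtain k c j where s: "a = node k c j" "2 \<le> k" "c < 4 ^ (k * k - k)" "j < k * k"
      by (rule statesE)
    then have "m \<le> k" using a by (auto simp: node_in_states)
    also have "k < a" using a s by (auto intro: less_node)
    finally show "m < a" .
  qed
  have "0 \<le> 1 / real a \<and> 1 / real a \<le> 1 / (real m + 1)" if "a = 0 \<or> m < a" for a
    using that by (auto simp: field_simps)
  moreover have "a = 0 \<or> m < a" "b = 0 \<or> m < b"
    using False assms less[OF assms(1)] less[OF assms(2)] by (auto simp: trunc_def split: if_splits)
  ultimately have "0 \<le> 1 / real a" "1 / real a \<le> 1 / (real m + 1)"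
      "0 \<le> 1 / real b" "1 / real b \<le> 1 / (real m + 1)" by blast+
  then show ?thesis by linarith
qed simp

lemma dist_of_agree:
  assumes "0 < e"
  obtains m where "\<And>x y. walk x \<Longrightarrow> walk y \<Longrightarrow> agree m x y \<Longrightarrow> dist (emb x) (emb y) < e"
proof -
  \<comment> \<open>The distance is at most twice the maximum over the first coordinates plus
    \<open>(1/2) ^ N\<close>. The tail gets less than \<open>e / 2\<close>; \<open>q\<close> makes
    each coordinate contribute at most \<open>e / 4\<close>; and \<open>m\<close> must exceed the
    index of every coordinate in the maximum.\<close>
  obtain N where N: "(1/2::real) ^ N < e / 2" 
    using real_arch_pow_inv[of "e/2" "1/2"] assms by auto
  obtain q where q: "4 / e < real q" using reals_Archimedean2 by blast
  define m where "m = Max (insert q (Suc ` from_nat ` {..N}))"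
  have qm: "q \<le> m" by (simp add: m_def)
  have im: "from_nat n < m" if "n \<le> N" for n
    using that unfolding m_def by (intro Suc_le_lessD Max_ge) auto
  have "dist (emb x) (emb y) < e" if "walk x" "walk y" "agree m x y" for x y
  proof -
    have *: "dist (emb x i) (emb y i) \<le> e / 4" if "i < m" for i
    proof -
      obtain a b where "x i \<in> states a" "y i \<in> states b"
        using walk_states[OF \<open>walk x\<close>] walk_states[OF \<open>walk y\<close>] by metis
      then have "dist (emb x i) (emb y i) \<le> 1 / (real m + 1)"
        unfolding emb_def dist_real_def using \<open>agree m x y\<close> that
        by (intro trunc_eq_imp_close) (auto simp: agree_def)
      also have "\<dots> \<le> e / 4"
      proof -
        have "4 / e \<le> real m + 1" using q qm by simp
        then show ?thesis using assms by (simp add: field_simps)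
      qed
      finally show ?thesis .
    qed
    have "dist (emb x) (emb y) \<le> 2 * Max {dist (emb x (from_nat n)) (emb y (from_nat n)) |n. n \<le> N} + (1/2)^N"
      by (rule dist_fun_le_dist_first_terms)
    also have "Max {dist (emb x (from_nat n)) (emb y (from_nat n)) |n. n \<le> N} \<le> e / 4"
    proof (subst Max_le_iff)
      show "\<forall>a\<in>{dist (emb x (from_nat n)) (emb y (from_nat n)) |n. n \<le> N}. a \<le> e / 4"
        using im * by blast
    qed auto
    finally show ?thesis using N by simp
  qed
  then show ?thesis using that by blast
qed

text \<open>Restates the topology in terms of \<open>agree\<close>, so that later arguments about
  open sets need no distances.\<close>

lemma openin_loop_space_iff:
  "openin (mtopology_of loop_metric) U \<longleftrightarrow> U \<subseteq> loop_space \<and>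
    (\<forall>x. emb x \<in> U \<longrightarrow> (\<exists>m. \<forall>y. walk y \<and> agree m x y \<longrightarrow> emb y \<in> U))"
proof
  assume "openin (mtopology_of loop_metric) U"
  then obtain V where V: "open V" "U = V \<inter> loop_space"
    by (auto simp: mtopology_of_submetric openin_subtopology)
  have "\<exists>m. \<forall>y. walk y \<and> agree m x y \<longrightarrow> emb y \<in> U" if "emb x \<in> U" for x
  proof -
    from that V obtain e where e: "0 < e" "\<And>z. dist z (emb x) < e \<Longrightarrow> z \<in> V"
      by (metis IntD1 open_dist)
    obtain m where "\<And>x y. walk x \<Longrightarrow> walk y \<Longrightarrow> agree m x y \<Longrightarrow> dist (emb x) (emb y) < e"
      using dist_of_agree[OF e(1)] by blast
    moreover have "walk x" using that V by simp
    ultimately show ?thesis using V e(2) by (metis IntI dist_commute emb_in_loop_space)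
  qed
  then show "U \<subseteq> loop_space \<and> (\<forall>x. emb x \<in> U \<longrightarrow> (\<exists>m. \<forall>y. walk y \<and> agree m x y \<longrightarrow> emb y \<in> U))"
    using V by auto
next
  assume *: "U \<subseteq> loop_space \<and> (\<forall>x. emb x \<in> U \<longrightarrow> (\<exists>m. \<forall>y. walk y \<and> agree m x y \<longrightarrow> emb y \<in> U))"
  have "\<exists>e>0. \<forall>z\<in>loop_space. dist z y < e \<longrightarrow> z \<in> U" if "y \<in> U" for y
  proof -
    have "y \<in> loop_space" using * that by blast
    then obtain x where x: "y = emb x" by (rule loop_spaceE)
    then have "emb x \<in> U" using that by simp
    then have "\<exists>m. \<forall>y. walk y \<and> agree m x y \<longrightarrow> emb y \<in> U" using * by blast
    then obtain m where m: "\<And>y. walk y \<Longrightarrow> agree m x y \<Longrightarrow> emb y \<in> U" by blast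
    obtain d where "0 < d" "\<And>x y. dist (emb x) (emb y) < d \<Longrightarrow> agree m x y"
      using agree_of_dist by blast
    then have "z \<in> U" if "z \<in> loop_space" "dist z y < d" for z
      using that m x by (auto simp: loop_space_def dist_commute)
    with \<open>0 < d\<close> show ?thesis by blast
  qed
  then have "openin (top_of_set loop_space) U" using * by (simp add: openin_euclidean_subtopology_iff)
  then show "openin (mtopology_of loop_metric) U"
    by (simp add: mtopology_of_submetric)
qed

section \<open>Compactness, continuity, transitivity and shadowing\<close>

lemma compact_loop_space: "compact loop_space"
proof -
  define S where "S = (\<Union>m. states m)"
  \<comment> \<open>Numbers that are not states are replaced by the hub, so a point of the compact
    product of copies of \<open>A\<close> is automatically the image of a sequence of states. It
    remains to see that being a walk is a closed condition.\<close>
  define A where "A = insert 0 (range (\<lambda>n. 1 / real (if n \<in> S then n else 0)))"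
  have "(\<lambda>n. 1 / real (if n \<in> S then n else 0)) \<longlonglongrightarrow> 0"
    by (rule real_tendsto_sandwich[OF _ _ tendsto_const lim_1_over_n]) (auto intro!: always_eventually)
  then have "compact A" unfolding A_def by (rule compact_sequence_with_limit)
  then have "compactin (product_topology (\<lambda>i::nat. euclidean) UNIV) (PiE UNIV (\<lambda>i. A))"
    by (simp add: compactin_PiE)
  then have compact: "compact (PiE UNIV (\<lambda>i::nat. A))"
    by (simp add: euclidean_product_topology)
  have AE: "\<exists>n. s = 1 / real n \<and> n \<in> S" if "s \<in> A" for s
    using that by (auto simp: A_def S_def)
  have "closed loop_space"
  unfolding closed_sequential_limits
  proof (intro allI impI, elim conjE)
    fix y l assume y: "\<forall>n. y n \<in> loop_space" and lim: "y \<longlonglongrightarrow> l"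
    obtain x where x: "\<And>n. walk (x n)" "\<And>n. y n = emb (x n)"
      using y unfolding loop_space_def image_iff Bex_def mem_Collect_eq by metis
    have "y n \<in> PiE UNIV (\<lambda>i. A)" for n
    proof -
      have "emb (x n) i \<in> A" for i
      proof -
        obtain m where "x n i \<in> states m" using walk_states[OF x(1)] .
        then have "x n i \<in> S" by (auto simp: S_def)
        then show ?thesis unfolding A_def emb_def by (intro insertI2) (auto intro!: image_eqI[of _ _ "x n i"])
      qed
      then show ?thesis by (auto simp: x)
    qed
    then have "l \<in> PiE UNIV (\<lambda>i. A)"
      using compact_imp_closed[OF compact] lim unfolding closed_sequential_limits by blast
    then have "\<forall>i. \<exists>n. l i = 1 / real n \<and> n \<in> S" using AE by (simp add: PiE_UNIV_domain Pi_iff)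
    then obtain z where z: "\<And>i. l i = 1 / real (z i)" "\<And>i. z i \<in> S" by metis
    have l: "l = emb z" using z by (auto simp: emb_def)
    have "edge (z i) (z (Suc i))" for i
    proof -
      obtain a b where "z i \<in> states a" "z (Suc i) \<in> states b" using z(2) unfolding S_def by blast
      moreover define m where "m = a + b + i + 2"
      ultimately have m: "z i \<in> states m" "z (Suc i) \<in> states m" "Suc i < m"
        using states_mono[of a m] states_mono[of b m] by auto
      obtain d where d: "0 < d" "\<And>x y. dist (emb x) (emb y) < d \<Longrightarrow> agree m x y"
        using agree_of_dist by blast
      obtain n where "dist (y n) l < d" using lim d(1) unfolding lim_sequentially by blast
      then have ag: "agree m (x n) z" using d(2) x(2) l by simp
      \<comment> \<open>By \<open>agree\<close> these two truncations equal those of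
        \<open>z i\<close> and \<open>z (Suc i)\<close>, and \<open>m\<close> was chosen so large
        that truncation fixes the latter two. Hence the edge survives in the limit.\<close>
      have "edge (trunc m (x n i)) (trunc m (x n (Suc i)))"
        using x(1) by (intro edge_trunc) (simp add: walk_def)
      then show ?thesis using ag m by (simp add: agree_def trunc_def)
    qed
    then show "l \<in> loop_space" by (simp add: l walk_def)
  qed
  moreover have "loop_space \<subseteq> PiE UNIV (\<lambda>i::nat. A)"
  proof
    fix y assume "y \<in> loop_space"
    then obtain x where x: "walk x" "y = emb x" by (rule loop_spaceE)
    have "emb x i \<in> A" for i
    proof -
      obtain m where "x i \<in> states m" using walk_states[OF x(1)] .
      then have "x i \<in> S" by (auto simp: S_def)
      then show ?thesis unfolding A_def emb_def by (intro insertI2) (auto intro!: image_eqI[of _ _ "x i"])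
    qed
    then show "y \<in> PiE UNIV (\<lambda>i. A)" by (auto simp: x)
  qed
  ultimately show ?thesis using compact compact_Int_closed by (metis inf.absorb2)
qed

lemma continuous_shift: "continuous_map (mtopology_of loop_metric) (mtopology_of loop_metric) shift"
proof -
  have "continuous_on UNIV (\<lambda>(y::nat \<Rightarrow> real) i. y (Suc i))"
    by (intro continuous_on_coordinatewise_then_product continuous_on_product_coordinates)
  then have "continuous_on loop_space shift"
    unfolding shift_def using continuous_on_subset by blast
  then show ?thesis
    using shift_loop_space by (auto simp: mtopology_of_submetric continuous_map_in_subtopology)
qed

lemma dynamical_system_loops: "dynamical_system loop_metric shift"
  unfolding dynamical_system_def
proof (intro conjI continuous_shift)
  show "mspace loop_metric \<noteq> {}" using emb_in_loop_space walk_const_0 by fastforce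
  show "compact_space (mtopology_of loop_metric)"
    using compact_loop_space by (simp add: mtopology_of_submetric compact_space_subtopology)
qed

lemma transitive_loops: "transitive_system loop_metric shift"
  unfolding transitive_system_def
proof (intro allI impI)
  fix U V
  assume *: "openin (mtopology_of loop_metric) U \<and> U \<noteq> {} \<and> openin (mtopology_of loop_metric) V \<and> V \<noteq> {}"
  then have sub: "U \<subseteq> loop_space" "V \<subseteq> loop_space" by (auto simp: openin_loop_space_iff)
  from * obtain u v where "u \<in> U" "v \<in> V" by blast
  with sub obtain x y where x: "walk x" "emb x \<in> U" and y: "walk y" "emb y \<in> V"
    unfolding loop_space_def by blast
  obtain m where m: "\<And>z. walk z \<Longrightarrow> agree m x z \<Longrightarrow> emb z \<in> U"
    using * x unfolding openin_loop_space_iff by meson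
  obtain z n where z: "walk z" "0 < n" "\<forall>i<m. z i = x i" "\<forall>i. z (i + n) = y i"
    using walk_join[OF x(1) y(1)] by blast
  have "emb z \<in> U" using z by (intro m) (auto simp: agree_def)
  moreover have "(shift ^^ n) (emb z) = emb y" using z by (simp add: funpow_shift_emb)
  ultimately show "\<exists>n>0. (shift ^^ n) ` U \<inter> V \<noteq> {}" using z y by (metis IntI empty_iff imageI)
qed

text \<open>The tracing point is read off from the truncated initial states of the members of the
  pseudo-orbit. The errors of the pseudo-orbit are invisible after truncation, so consecutive
  initial states are joined by a truncated edge, which is again an edge.\<close>

lemma shadowing_loops: "shadowing_property loop_metric shift"
  unfolding shadowing_property_def
proof (intro allI impI)
  fix e :: real assume "0 < e"
  then obtain m where m: "\<And>x y. walk x \<Longrightarrow> walk y \<Longrightarrow> agree m x y \<Longrightarrow> dist (emb x) (emb y) < e"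
    using dist_of_agree by blast
  \<comment> \<open>\<open>Suc m\<close> makes index 0 available even if \<open>m = 0\<close>; the
    comparison of the initial states needs it.\<close>
  obtain d where d: "0 < d" "\<And>x y. dist (emb x) (emb y) < d \<Longrightarrow> agree (Suc m) x y"
    using agree_of_dist by blast
  have "\<exists>y\<in>mspace loop_metric. traces loop_metric shift e y p" if po: "pseudo_orbit loop_metric shift d p" for p
  proof -
    have "range p \<subseteq> loop_space" using po by (simp add: pseudo_orbit_def)
    then have "\<forall>n. \<exists>x. walk x \<and> p n = emb x" by (fastforce simp: loop_space_def)
    then obtain x where x: "\<And>n. walk (x n)" "\<And>n. p n = emb (x n)" by metis
    have step: "trunc m (x n (Suc i)) = trunc m (x (Suc n) i)" if "i \<le> m" for n i
    proof -
      have "dist (emb (\<lambda>i. x n (i + 1))) (emb (x (Suc n))) < d"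
        using po by (simp add: pseudo_orbit_def x shift_emb)
      then have "agree (Suc m) (\<lambda>i. x n (i + 1)) (x (Suc n))" by (rule d)
      then have "trunc (Suc m) (x n (Suc i)) = trunc (Suc m) (x (Suc n) i)"
        using that by (simp add: agree_def)
      then show ?thesis by (metis trunc_trunc le_SucI order_refl)
    qed
    \<comment> \<open>Iterating the previous step trades one coordinate for one time step until
      coordinate 0 is reached.\<close>
    have step': "trunc m (x n i) = trunc m (x (n + i) 0)" if "i \<le> m" for n i
      using that
    proof (induction i arbitrary: n)
      case (Suc i)
      then show ?case using step[of i n] Suc.IH[of "Suc n"] by simp
    qed simp
    define z where "z n = trunc m (x n 0)" for n
    have "walk z" unfolding walk_def
    proof
      fix n
      have "edge (trunc m (x n 0)) (trunc m (x n (Suc 0)))" using x(1) by (intro edge_trunc) (simp add: walk_def)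
      then show "edge (z n) (z (Suc n))" using step[of 0 n] by (simp add: z_def)
    qed
    moreover have "dist (emb (\<lambda>i. z (i + n))) (emb (x n)) < e" for n
    proof (rule m[OF walk_shift[OF \<open>walk z\<close>] x(1)])
      show "agree m (\<lambda>i. z (i + n)) (x n)"
        unfolding agree_def z_def using step'[of _ n] by (auto simp: trunc_trunc add.commute)
    qed
    ultimately show ?thesis
      by (intro bexI[of _ "emb z"]) (auto simp: traces_def funpow_shift_emb x)
  qed
  then show "\<exists>\<delta>>0. \<forall>x. pseudo_orbit loop_metric shift \<delta> x \<longrightarrow> (\<exists>y\<in>mspace loop_metric. traces loop_metric shift e y x)"
    using d(1) by blast
qed

subsection \<open>A lower bound for the topological entropy\<close>

text \<open>The walk that starts at the hub and runs through the loops of length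
  \<open>k * k\<close> labelled \<open>s 0\<close>, \<open>s 1\<close>, and so on. At multiples of
  \<open>k * k\<close> it is at the hub, where the countdown formula would give \<open>k * k\<close>
  in place of 0.\<close>

definition loop_word :: "nat \<Rightarrow> (nat \<Rightarrow> nat) \<Rightarrow> nat \<Rightarrow> nat" where
  "loop_word k s i = node k (s (i div (k * k))) (if i mod (k * k) = 0 then 0 else k * k - i mod (k * k))"

lemma walk_loop_word:
  assumes "2 \<le> k" "\<And>j. s j < 4 ^ (k * k - k)"
  shows "walk (loop_word k s)"
  unfolding walk_def
proof
  fix i
  define q where "q = k * k"
  have q: "2 * 2 \<le> q" unfolding q_def using assms(1) by (intro mult_le_mono) auto
  define r where "r = i mod q"
  have "r < q" using q by (simp add: r_def)
  consider "r = 0" | "r \<noteq> 0" "Suc r < q" | "r \<noteq> 0" "Suc r = q" using \<open>r < q\<close> by linarith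
  then show "edge (loop_word k s i) (loop_word k s (Suc i))"
  proof cases
    case 1
    then show ?thesis using edge.enter[OF assms, of "i div q"] q
      by (simp add: loop_word_def flip: q_def r_def) (simp add: mod_Suc div_Suc flip: r_def)
  next
    case 2
    then have "q - r = Suc (q - Suc r)" "Suc (q - Suc r) < q" by auto
    then show ?thesis using edge.step[OF assms, of "q - Suc r" "i div q"] 2
      by (simp add: loop_word_def flip: q_def r_def) (simp add: mod_Suc div_Suc flip: r_def)
  next
    case 3
    then have "q - r = Suc 0" by auto
    then show ?thesis using edge.step[OF assms, of 0 "i div q"] 3 q
      by (simp add: loop_word_def flip: q_def r_def) (simp add: mod_Suc div_Suc flip: r_def)
  qed
qed

text \<open>At time \<open>j * (k * k) + 1\<close> the walk has just entered its loop number
  \<open>j\<close>, and this node reveals the label. Nodes with different labels are different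
  elements of \<open>states (Suc k)\<close>, so truncation keeps them apart by a distance that
  depends on \<open>k\<close> only.\<close>

lemma loop_word_separated:
  assumes k: "2 \<le> k"
  shows "\<exists>e>0. \<forall>s s' j. s j < 4 ^ (k * k - k) \<longrightarrow> s' j < 4 ^ (k * k - k) \<longrightarrow> s j \<noteq> s' j \<longrightarrow>
      e < dist ((shift ^^ (j * (k * k) + 1)) (emb (loop_word k s)))
            ((shift ^^ (j * (k * k) + 1)) (emb (loop_word k s')))"
proof -
  obtain d where d: "0 < d" "\<And>x y. dist (emb x) (emb y) < d \<Longrightarrow> agree (Suc k) x y"
    using agree_of_dist by blast
  define q where "q = k * k"
  have q: "2 * 2 \<le> q" unfolding q_def using assms(1) by (intro mult_le_mono) auto
  \<comment> \<open>Separation is a strict inequality. Its failure for \<open>d / 2\<close> leaves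
    the distance strictly below \<open>d\<close>.\<close>
  have "d / 2 < dist ((shift ^^ (j * q + 1)) (emb (loop_word k s))) ((shift ^^ (j * q + 1)) (emb (loop_word k s')))"
    if s: "s j < 4 ^ (k * k - k)" "s' j < 4 ^ (k * k - k)" "s j \<noteq> s' j" for s s' j
  proof (rule ccontr)
    assume "\<not> ?thesis"
    then have "agree (Suc k) (\<lambda>i. loop_word k s (i + (j * q + 1))) (\<lambda>i. loop_word k s' (i + (j * q + 1)))"
      using d(1) by (intro d(2), unfold funpow_shift_emb[symmetric]) linarith
    then have "trunc (Suc k) (loop_word k s (j * q + 1)) = trunc (Suc k) (loop_word k s' (j * q + 1))"
      unfolding agree_def by (metis add_0 zero_less_Suc)
    moreover have w: "loop_word k t (j * q + 1) = node k (t j) (q - 1)" for t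
      using q by (simp add: loop_word_def mod_Suc div_Suc flip: q_def)
    moreover have "node k (s j) (q - 1) \<in> states (Suc k)" "node k (s' j) (q - 1) \<in> states (Suc k)"
      using node_in_states[OF k s(1), of "q - 1"] node_in_states[OF k s(2), of "q - 1"] q
      by (auto simp flip: q_def)
    ultimately show False using s(3) q by (auto simp: trunc_def node_inject)
  qed
  then show ?thesis using d(1) unfolding q_def by (intro exI[of _ "d / 2"]) simp
qed

text \<open>In time \<open>Suc p * q\<close> there are \<open>Suc p\<close> loops of length
  \<open>q\<close>, each with \<open>4 ^ (q - k)\<close> free labels. The resulting walks are
  separated, and their exponential rate is \<open>(q - k) / q * ln 4\<close>.\<close>

lemma top_entropy_loops_ge:
  assumes k: "2 \<le> k"
  shows "ereal ((1 - 1 / real k) * ln 4) \<le> top_entropy loop_metric shift"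
proof -
  define q where "q = k * k"
  define f :: nat where "f = 4 ^ (q - k)"
  have q: "0 < q" "k \<le> q" using k by (auto simp: q_def)
  obtain e where e0: "0 < e" and sep_all:
    "\<forall>s s' j. s j < f \<longrightarrow> s' j < f \<longrightarrow> s j \<noteq> s' j \<longrightarrow>
      e < dist ((shift ^^ (j * q + 1)) (emb (loop_word k s))) ((shift ^^ (j * q + 1)) (emb (loop_word k s')))"
    using loop_word_separated[OF k, folded q_def, folded f_def] by (elim exE conjE)
  let ?F = "\<lambda>n. SUP E\<in>{E. finite E \<and> dyn_separated loop_metric shift n e E}. ereal (ln (real (card E)) / real n)"
  have rate: "ereal ((1 - 1 / real k) * ln 4) \<le> ?F (Suc p * q)" for p
  proof -
    define D where "D = PiE {..<Suc p} (\<lambda>_. {..<f})"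
    \<comment> \<open>Members of \<open>D\<close> are undefined beyond \<open>p\<close>; label 0 is
      a legal choice for all later loops.\<close>
    define ext where "ext s j = (if j < Suc p then s j else 0)" for s :: "nat \<Rightarrow> nat" and j
    define E where "E = (\<lambda>s. emb (loop_word k (ext s))) ` D"
    have ext: "ext s j < f" if "s \<in> D" for s j
      using that by (auto simp: ext_def D_def f_def PiE_iff)
    have sep: "\<exists>i<Suc p * q. e < dist ((shift ^^ i) (emb (loop_word k (ext s)))) ((shift ^^ i) (emb (loop_word k (ext t))))"
      if "s \<in> D" "t \<in> D" "s \<noteq> t" for s t
    proof -
      have "\<exists>j<Suc p. s j \<noteq> t j"
      proof (rule ccontr)
        assume "\<not> ?thesis"
        then have "s = t" using that(1,2) unfolding D_def by (intro PiE_ext) auto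
        then show False using that(3) by simp
      qed
      then obtain j where j: "j < Suc p" "s j \<noteq> t j" by blast
      have "k * 2 \<le> q" unfolding q_def using k by (intro mult_le_mono2)
      then have "j * q + 1 < Suc j * q" using k by simp
      also have "\<dots> \<le> Suc p * q" using j(1) by (intro mult_le_mono1) simp
      finally have "j * q + 1 < Suc p * q" .
      moreover have "ext s j \<noteq> ext t j" using j by (simp add: ext_def)
      ultimately show ?thesis using sep_all[rule_format, where s = "ext s" and s' = "ext t" and j = j] ext that by blast
    qed
    have "inj_on (\<lambda>s. emb (loop_word k (ext s))) D"
    proof (rule inj_onI, rule ccontr)
      fix s t assume "s \<in> D" "t \<in> D" "emb (loop_word k (ext s)) = emb (loop_word k (ext t))" "s \<noteq> t"
      with sep[of s t] e0 show False by simp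
    qed
    then have card: "card E = f ^ Suc p"
      unfolding E_def by (simp add: card_image D_def card_PiE)
    have "finite E" unfolding E_def D_def by (intro finite_imageI finite_PiE) auto
    moreover have "dyn_separated loop_metric shift (Suc p * q) e E"
      unfolding dyn_separated_def
    proof (intro conjI ballI impI)
      show "E \<subseteq> mspace loop_metric"
        unfolding E_def using ext by (auto intro!: walk_loop_word k simp: f_def q_def)
    next
      fix x y assume "x \<in> E" "y \<in> E" "x \<noteq> y"
      then obtain s t where "x = emb (loop_word k (ext s))" "y = emb (loop_word k (ext t))"
          "s \<in> D" "t \<in> D" "s \<noteq> t" unfolding E_def by blast
      with sep[of s t] show "\<exists>i<Suc p * q. e < mdist loop_metric ((shift ^^ i) x) ((shift ^^ i) y)" by simp
    qed
    ultimately have "ereal (ln (real (card E)) / real (Suc p * q)) \<le> ?F (Suc p * q)"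
      by (intro SUP_upper) simp
    moreover have "ln (real (card E)) / real (Suc p * q) = (1 - 1 / real k) * ln 4"
    proof -
      define P where "P = real (Suc p)"
      have "P > 0" by (simp add: P_def)
      have "ln (real (card E)) = P * (real (q - k) * ln 4)"
        unfolding card f_def P_def of_nat_power by (simp only: ln_realpow zero_less_power zero_less_numeral of_nat_numeral)
      moreover have "real (Suc p * q) = P * real q" unfolding P_def by (rule of_nat_mult)
      moreover have "real (q - k) / real q = 1 - 1 / real k"
        using q k by (simp add: of_nat_diff diff_divide_distrib) (simp add: q_def)
      ultimately show ?thesis using \<open>P > 0\<close> by (metis mult_divide_mult_cancel_left order_less_irrefl times_divide_eq_left)
    qed
    ultimately show ?thesis by simp
  qed
  \<comment> \<open>The rate is known along multiples of \<open>q\<close> only, which suffices to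
    bound the limsup from below.\<close>
  have "strict_mono (\<lambda>p. Suc p * q)" using q(1) by (auto simp: strict_mono_def)
  then have "limsup (?F \<circ> (\<lambda>p. Suc p * q)) \<le> limsup ?F" by (rule limsup_subseq_mono)
  moreover have "ereal ((1 - 1 / real k) * ln 4) \<le> limsup (?F \<circ> (\<lambda>p. Suc p * q))"
    unfolding comp_def by (intro le_Limsup trivial_limit_sequentially always_eventually allI rate)
  moreover have "limsup ?F \<le> top_entropy loop_metric shift"
    unfolding top_entropy_def using e0 by (intro SUP_upper) simp
  ultimately show ?thesis by (meson order_trans)
qed

lemma ln_4_le_top_entropy_loops: "ereal (ln 4) \<le> top_entropy loop_metric shift"
proof (rule LIMSEQ_le_const2)
  show "(\<lambda>k. ereal ((1 - 1 / real k) * ln 4)) \<longlonglongrightarrow> ereal (ln 4)"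
  proof -
    have "(\<lambda>k. (1 - 1 / real k) * ln 4) \<longlonglongrightarrow> (1 - 0) * ln 4"
      by (intro tendsto_intros lim_1_over_n)
    then show ?thesis by simp
  qed
  show "\<exists>N. \<forall>k\<ge>N. ereal ((1 - 1 / real k) * ln 4) \<le> top_entropy loop_metric shift"
    using top_entropy_loops_ge by blast
qed

subsection \<open>Gibbs' inequality and weights of words\<close>

text \<open>Termwise this is \<open>ln t \<le> t - 1\<close> at \<open>t = w A / p A\<close>,
  multiplied by \<open>p A\<close>. Summation leaves
  \<open>sum w R - sum p R \<le> 0\<close>.\<close>

lemma gibbs_inequality:
  fixes p w :: "'a \<Rightarrow> real"
  assumes "finite R" "\<And>A. A \<in> R \<Longrightarrow> 0 \<le> p A" "\<And>A. A \<in> R \<Longrightarrow> 0 < w A"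
    and "sum w R \<le> 1" "sum p R = 1"
  shows "- (\<Sum>A\<in>R. p A * ln (p A)) \<le> - (\<Sum>A\<in>R. p A * ln (w A))"
proof -
  have "p A * ln (w A) - p A * ln (p A) \<le> w A - p A" if "A \<in> R" for A
  proof (cases "p A = 0")
    case False
    then have "0 < p A" using assms(2)[OF that] by simp
    then have "p A * ln (w A) - p A * ln (p A) = p A * ln (w A / p A)"
      using assms(3)[OF that] by (simp add: ln_div right_diff_distrib)
    also have "\<dots> \<le> p A * (w A / p A - 1)"
      using \<open>0 < p A\<close> assms(3)[OF that] by (intro mult_left_mono ln_le_minus_one) auto
    also have "\<dots> = w A - p A" using \<open>0 < p A\<close> by (simp add: right_diff_distrib)
    finally show ?thesis .
  qed (use assms(3)[OF that] in simp)
  then have "(\<Sum>A\<in>R. p A * ln (w A) - p A * ln (p A)) \<le> (\<Sum>A\<in>R. w A - p A)"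
    by (rule sum_mono)
  then show ?thesis using assms(4,5) by (simp add: sum_subtractf)
qed

text \<open>Gibbs' inequality bounds the entropy by the integral of the step function with value
  \<open>- ln (w A)\<close> on \<open>A\<close>. That function lies below \<open>f\<close>.\<close>

lemma partition_entropy_le_integral:
  assumes "prob_space \<mu>" "finite R" "R \<subseteq> sets \<mu>" "partition_on (space \<mu>) R"
    and w: "\<And>A. A \<in> R \<Longrightarrow> 0 < w A" "sum w R \<le> 1"
    and f: "integrable \<mu> f" "\<And>A y. A \<in> R \<Longrightarrow> y \<in> A \<Longrightarrow> - ln (w A) \<le> f y"
  shows "partition_entropy \<mu> R \<le> (\<integral>y. f y \<partial>\<mu>)"
proof -
  interpret prob_space \<mu> by fact
  have disj: "disjoint R" and cover: "space \<mu> = \<Union>R"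
    using assms(4) by (auto simp: partition_on_def)
  have "measure \<mu> (\<Union>R) = (\<Sum>A\<in>R. measure \<mu> A)"
    using assms(2,3) disj by (intro measure_Union') (auto simp: disjoint_def disjnt_def pairwise_def fmeasurable_eq_sets)
  then have total: "(\<Sum>A\<in>R. measure \<mu> A) = 1" using prob_space cover by simp
  have "partition_entropy \<mu> R \<le> - (\<Sum>A\<in>R. measure \<mu> A * ln (w A))"
    unfolding partition_entropy_def using assms total by (intro gibbs_inequality) auto
  also have "\<dots> = (\<integral>y. (\<Sum>A\<in>R. indicator A y * - ln (w A)) \<partial>\<mu>)"
    using assms(3) by (subst Bochner_Integration.integral_sum)
      (auto simp: sum_negf subset_eq emeasure_eq_measure intro!: integrable_mult_left integrable_real_indicator)
  also have "\<dots> \<le> (\<integral>y. f y \<partial>\<mu>)"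
  proof (rule integral_mono[OF _ f(1)])
    show "integrable \<mu> (\<lambda>y. \<Sum>A\<in>R. indicator A y * - ln (w A))"
      using assms(3) by (intro Bochner_Integration.integrable_sum integrable_mult_left integrable_real_indicator)
        (auto simp: subset_eq emeasure_eq_measure)
    fix y assume "y \<in> space \<mu>"
    then obtain A where A: "A \<in> R" "y \<in> A" using cover by auto
    have "indicator B y * - ln (w B) = 0" if "B \<in> R - {A}" for B
      using that A disj by (auto simp: disjoint_def indicator_def)
    then have "(\<Sum>B\<in>R - {A}. indicator B y * - ln (w B)) = 0" by (intro sum.neutral) blast
    then have "(\<Sum>B\<in>R. indicator B y * - ln (w B)) = - ln (w A)"
      using A assms(2) by (simp only: sum.remove[of R A]) simp
    then show "(\<Sum>B\<in>R. indicator B y * - ln (w B)) \<le> f y" using f(2)[OF A] by simp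
  qed
  finally show ?thesis .
qed

section \<open>Iterated joins described by itineraries\<close>

lemma iterated_join_cylinder:
  assumes "X \<noteq> {}" "A \<in> iterated_join X T P n"
  shows "A \<noteq> {} \<and> (\<exists>L\<in>PiE {..<n} (\<lambda>_. P). A = {x \<in> X. \<forall>i<n. (T ^^ i) x \<in> L i})"
  using assms(2)
proof (induction n arbitrary: A)
  case 0
  then show ?case using assms(1) by auto
next
  case (Suc n)
  then obtain B C where BC: "A = B \<inter> ((T ^^ n) -` C \<inter> X)" "A \<noteq> {}" "B \<in> iterated_join X T P n" "C \<in> P"
    by (auto simp: partition_join_def partition_pullback_def)
  obtain L where L: "L \<in> PiE {..<n} (\<lambda>_. P)" "B = {x \<in> X. \<forall>i<n. (T ^^ i) x \<in> L i}"
    using Suc.IH[OF BC(3)] by blast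
  have "L(n := C) \<in> PiE {..<Suc n} (\<lambda>_. P)"
    using L(1) BC(4) by (auto simp: PiE_iff extensional_def)
  moreover have "A = {x \<in> X. \<forall>i<Suc n. (T ^^ i) x \<in> (L(n := C)) i}"
    using L(2) BC(1) by (auto simp: less_Suc_eq)
  ultimately show ?case using BC(2) by blast
qed

text \<open>Disjointness: a common point of two members lies in only one atom of \<open>P\<close> at
  each time, so the two itineraries coincide.\<close>

lemma partition_on_iterated_join:
  assumes "partition_on X P" "X \<noteq> {}" "T \<in> X \<rightarrow> X"
  shows "partition_on X (iterated_join X T P n)"
proof (rule partition_onI)
  have T: "(T ^^ i) x \<in> X" if "x \<in> X" for x i
    using that assms(3) by (induction i) auto
  have "\<exists>A\<in>iterated_join X T P n. x \<in> A" if x: "x \<in> X" for x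
  proof (induction n)
    case 0
    then show ?case using x by simp
  next
    case (Suc n)
    then obtain A where A: "A \<in> iterated_join X T P n" "x \<in> A" by blast
    obtain B where B: "B \<in> P" "(T ^^ n) x \<in> B" using T[OF x] assms(1) by (auto simp: partition_on_def)
    have "(T ^^ n) -` B \<inter> X \<in> partition_pullback X (T ^^ n) P"
      using B x by (auto simp: partition_pullback_def)
    then have mem: "A \<inter> ((T ^^ n) -` B \<inter> X) \<in> iterated_join X T P (Suc n)"
      using A B x by (auto simp: partition_join_def)
    show ?case by (rule bexI[OF _ mem]) (use A B x in simp)
  qed
  moreover have "A \<subseteq> X" if A: "A \<in> iterated_join X T P n" for A
  proof -
    obtain L where "A = {x \<in> X. \<forall>i<n. (T ^^ i) x \<in> L i}"
      using iterated_join_cylinder[OF assms(2) A] by (elim conjE bexE)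
    then show ?thesis by simp
  qed
  ultimately show "\<Union>(iterated_join X T P n) = X" by blast
  fix A B assume AB: "A \<in> iterated_join X T P n" "B \<in> iterated_join X T P n" "A \<noteq> B"
  obtain L M where L: "L \<in> PiE {..<n} (\<lambda>_. P)" "A = {x \<in> X. \<forall>i<n. (T ^^ i) x \<in> L i}"
    and M: "M \<in> PiE {..<n} (\<lambda>_. P)" "B = {x \<in> X. \<forall>i<n. (T ^^ i) x \<in> M i}"
    using iterated_join_cylinder[OF assms(2) AB(1)] iterated_join_cylinder[OF assms(2) AB(2)]
    by (elim conjE bexE)
  show "disjnt A B"
  proof (rule ccontr)
    assume "\<not> disjnt A B"
    then obtain x where x: "x \<in> A" "x \<in> B" by (auto simp: disjnt_def)
    have "L i = M i" if "i < n" for i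
    proof -
      have "L i \<in> P" "M i \<in> P" using L(1) M(1) that by auto
      moreover have "(T ^^ i) x \<in> L i" "(T ^^ i) x \<in> M i" using x L M that by auto
      ultimately show ?thesis using assms(1) by (auto simp: partition_on_def disjoint_def)
    qed
    then show False using L(2) M(2) AB(3) by auto
  qed
next
  show "{} \<notin> iterated_join X T P n" using iterated_join_cylinder[OF assms(2), of "{}"] by auto
qed

lemma finite_iterated_join: "finite P \<Longrightarrow> finite (iterated_join X T P n)"
proof (induction n)
  case (Suc n)
  have "iterated_join X T P (Suc n) \<subseteq>
      (\<lambda>(A, B). A \<inter> B) ` (iterated_join X T P n \<times> partition_pullback X (T ^^ n) P)"
    by (auto simp: partition_join_def)
  moreover have "finite (partition_pullback X (T ^^ n) P)"
    using Suc.prems by (simp add: partition_pullback_def)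
  ultimately show ?case using Suc by (meson finite_SigmaI finite_imageI finite_subset)
qed simp

lemma iterated_join_sets:
  assumes "P \<subseteq> sets \<mu>" "T \<in> measurable \<mu> \<mu>"
  shows "iterated_join (space \<mu>) T P n \<subseteq> sets \<mu>"
proof (induction n)
  case (Suc n)
  have "T ^^ n \<in> measurable \<mu> \<mu>" using assms(2) by (rule measurable_compose_n)
  then have "(T ^^ n) -` B \<inter> space \<mu> \<in> sets \<mu>" if "B \<in> P" for B
    using assms(1) that by (auto intro: measurable_sets)
  then show ?case using Suc by (auto simp: partition_join_def partition_pullback_def)
qed simp

lemma measure_funpow_vimage:
  assumes "invariant_measure T \<mu>" "A \<in> sets \<mu>"
  shows "(T ^^ n) -` A \<inter> space \<mu> \<in> sets \<mu>" "measure \<mu> ((T ^^ n) -` A \<inter> space \<mu>) = measure \<mu> A"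
proof -
  have T: "T \<in> measurable \<mu> \<mu>" using assms(1) by (simp add: invariant_measure_def)
  show sets: "(T ^^ n) -` A \<inter> space \<mu> \<in> sets \<mu>" for n
    using measurable_compose_n[OF T] assms(2) by (rule measurable_sets)
  show "measure \<mu> ((T ^^ n) -` A \<inter> space \<mu>) = measure \<mu> A"
  proof (induction n)
    case 0
    have "A \<inter> space \<mu> = A" using sets.sets_into_space[OF assms(2)] by auto
    then show ?case by simp
  next
    case (Suc n)
    have "(T ^^ Suc n) -` A \<inter> space \<mu> = T -` ((T ^^ n) -` A \<inter> space \<mu>) \<inter> space \<mu>"
      using measurable_space[OF T] by (auto simp: funpow_Suc_right simp del: funpow.simps)
    moreover have "measure \<mu> (T -` ((T ^^ n) -` A \<inter> space \<mu>) \<inter> space \<mu>) = measure \<mu> ((T ^^ n) -` A \<inter> space \<mu>)"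
      using assms(1) sets[of n] unfolding invariant_measure_def by blast
    ultimately show ?case using Suc by (simp only:)
  qed
qed

text \<open>The members of \<open>R\<close> are coded injectively by itineraries. Over all
  itineraries the sum of the products factors into a product of sums that are at most 1.\<close>

lemma sum_prod_kernel_le_1:
  fixes \<kappa> :: "nat \<Rightarrow> 'b \<Rightarrow> real"
  assumes "finite P" "inj_on L R" "L ` R \<subseteq> PiE {..<n} (\<lambda>_. P)"
    and "\<And>i B. 0 \<le> \<kappa> i B" "\<And>i. (\<Sum>B\<in>P. \<kappa> i B) \<le> 1"
  shows "(\<Sum>A\<in>R. \<Prod>i<n. \<kappa> i (L A i)) \<le> 1"
proof -
  have "(\<Sum>A\<in>R. \<Prod>i<n. \<kappa> i (L A i)) = (\<Sum>l\<in>L ` R. \<Prod>i<n. \<kappa> i (l i))"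
    using assms(2) by (simp add: sum.reindex)
  also have "\<dots> \<le> (\<Sum>l\<in>PiE {..<n} (\<lambda>_. P). \<Prod>i<n. \<kappa> i (l i))"
    using assms by (intro sum_mono2 finite_PiE prod_nonneg) auto
  also have "\<dots> = (\<Prod>i<n. \<Sum>B\<in>P. \<kappa> i B)"
    using assms(1) by (subst prod_sum_PiE) auto
  also have "\<dots> \<le> 1" using assms(4,5) by (intro prod_le_1) (auto intro: sum_nonneg)
  finally show ?thesis .
qed

section \<open>Weights of words in the loop graph\<close>

definition out_weight :: "nat \<Rightarrow> real" where
  "out_weight a = (if a = 0 then 1 / 2 else 1 / 4)"

text \<open>Words that are not paths get weight 0. The last letter contributes no factor, so a path
  of \<open>n + 1\<close> letters carries \<open>n\<close> factors. The doubled factor at the hub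
  later yields the gain \<open>ln 2\<close> per visit.\<close>

fun word_weight :: "nat list \<Rightarrow> real" where
  "word_weight (a # b # u) = (if edge a b then out_weight a else 0) * word_weight (b # u)"
| "word_weight _ = 1"

lemma out_weight_pos [simp]: "0 < out_weight a" "0 \<le> out_weight a"
  by (auto simp: out_weight_def)

lemma word_weight_nonneg: "0 \<le> word_weight u"
  by (induction u rule: word_weight.induct) auto

lemma word_weight_walk:
  assumes "walk x"
  shows "word_weight (map x [0..<Suc n]) = (\<Prod>i<n. out_weight (x i))"
  using assms
proof (induction n arbitrary: x)
  case (Suc n)
  have "map x [0..<Suc (Suc n)] = x 0 # x 1 # map (\<lambda>i. x (Suc (Suc i))) [0..<n]"
    by (simp add: map_upt_Suc del: upt_Suc)
  moreover have "map (\<lambda>i. x (Suc i)) [0..<Suc n] = x 1 # map (\<lambda>i. x (Suc (Suc i))) [0..<n]"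
    by (simp add: map_upt_Suc del: upt_Suc)
  moreover have "edge (x 0) (x 1)" using Suc.prems by (simp add: walk_def)
  moreover have "walk (\<lambda>i. x (Suc i))" using walk_shift[OF Suc.prems, of 1] by simp
  ultimately show ?case using Suc.IH[of "\<lambda>i. x (Suc i)"] by (simp add: prod.lessThan_Suc_shift del: upt_Suc prod.lessThan_Suc)
qed simp

lemma sum_quarter_powers: "(\<Sum>k\<in>{2..<m}. 4 * (1/4::real) ^ k) \<le> 1"
proof (cases "2 \<le> m")
  case True
  \<comment> \<open>The subtracted multiple of \<open>(1/4) ^ m\<close> is there for the induction:
    with \<open>t = (1/4) ^ n\<close> the step needs
    \<open>- 6 * t + 4 * t \<le> - 6 * t / 4\<close>.\<close>
  then have "(\<Sum>k\<in>{2..<m}. 4 * (1/4::real) ^ k) \<le> 1 - 6 * (1/4) ^ m"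
  proof (induction m rule: dec_induct)
    case (step n)
    have "0 \<le> (1/4::real) ^ n" by simp
    moreover have "(\<Sum>k\<in>{2..<Suc n}. 4 * (1/4::real) ^ k) = (\<Sum>k\<in>{2..<n}. 4 * (1/4) ^ k) + 4 * (1/4) ^ n"
      using step(1) by simp
    moreover have "(1/4::real) ^ Suc n = (1/4) ^ n / 4" by simp
    ultimately show ?case using step(3) by linarith
  qed (simp add: power2_eq_square)
  also have "\<dots> \<le> 1" by simp
  finally show ?thesis .
qed simp

text \<open>The function \<open>a \<mapsto> 4 ^ (- steps a)\<close> is superharmonic for the weights, which keeps the total weight
  of the words of a given length bounded.\<close>

lemma sum_successors_le:
  assumes "a \<in> states m"
  shows "out_weight a * (\<Sum>b\<in>{b \<in> states m. edge a b}. (1/4) ^ steps b) \<le> (1/4) ^ steps a"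
proof (cases "a = 0")
  case False
  from assms obtain k c j where a: "a = node k c j" by (rule statesE)
  then obtain i where i: "j = Suc i" using False by (cases j) auto
  have "b = node k c i" if "edge a b" for b
    using edge_step_node[OF that False] by (auto simp: a i node_inject)
  then have "(\<Sum>b\<in>{b \<in> states m. edge a b}. (1/4::real) ^ steps b) \<le> (\<Sum>b\<in>{node k c i}. (1/4) ^ steps b)"
    by (intro sum_mono2) auto
  then show ?thesis using False by (simp add: out_weight_def a i)
next
  case True
  define D :: "(nat \<times> nat) set" where "D = (SIGMA k : {2..<m}. {..<4 ^ (k * k - k)})"
  let ?f = "\<lambda>(k, c). node k c (k * k - 1)"
  have [simp]: "finite D" by (simp add: D_def)
  have "{b \<in> states m. edge 0 b} \<subseteq> insert 0 (?f ` D)"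
  proof
    fix b assume "b \<in> {b \<in> states m. edge 0 b}"
    then have b: "b \<in> states m" "edge 0 b" by auto
    from b(2) show "b \<in> insert 0 (?f ` D)"
    proof cases
      case (enter k c)
      have "b = 0 \<or> k < m" using b(1) enter node_in_states[of k c "k * k - 1" m] by auto
      then show ?thesis using enter by (auto simp: D_def intro!: rev_image_eqI[of "(k, c)"])
    qed auto
  qed
  then have "(\<Sum>b\<in>{b \<in> states m. edge 0 b}. (1/4::real) ^ steps b) \<le> (\<Sum>b\<in>insert 0 (?f ` D). (1/4) ^ steps b)"
    by (intro sum_mono2) auto
  \<comment> \<open>The 1 comes from staying at the hub. The entrances to loops with parameter
    \<open>k\<close> contribute
    \<open>4 ^ (k * k - k) * (1/4) ^ (k * k - 1) = 4 * (1/4) ^ k\<close>, in total at most 1. The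
    factor \<open>1 / 2\<close> at the hub turns the sum 2 into the required 1.\<close>
  also have "\<dots> \<le> 1 + (\<Sum>b\<in>?f ` D. (1/4) ^ steps b)"
    by (simp add: sum.insert_if)
  also have "(\<Sum>b\<in>?f ` D. (1/4::real) ^ steps b) \<le> (\<Sum>d\<in>D. (1/4) ^ steps (?f d))"
    by (intro sum_image_le[of D "\<lambda>b. (1/4) ^ steps b" ?f, unfolded comp_def]) auto
  also have "\<dots> = (\<Sum>k\<in>{2..<m}. \<Sum>c<(4::nat) ^ (k * k - k). (1/4) ^ (k * k - 1))"
    unfolding D_def by (subst sum.Sigma) (auto simp: split_def)
  also have "\<dots> = (\<Sum>k\<in>{2..<m}. 4 * (1/4) ^ k)"
  proof (rule sum.cong[OF refl])
    fix k assume "k \<in> {2..<m}"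
    then obtain l where l: "k = Suc l" by (cases k) auto
    then have e: "k * k - 1 = l + (k * k - k)" by simp
    have "(1/4::real) ^ (k * k - 1) = 4 * (1/4) ^ k * (1/4) ^ (k * k - k)"
      unfolding e power_add by (simp add: l)
    moreover have "(4::real) ^ (k * k - k) * (1/4) ^ (k * k - k) = 1"
      by (simp flip: power_mult_distrib)
    ultimately show "(\<Sum>c<(4::nat) ^ (k * k - k). (1/4::real) ^ (k * k - 1)) = 4 * (1/4) ^ k"
      by (simp add: mult.commute mult.left_commute)
  qed
  also have "\<dots> \<le> 1" by (rule sum_quarter_powers)
  finally show ?thesis using True by (simp add: out_weight_def)
qed

lemma sum_lists_Suc:
  "(\<Sum>u | set u \<subseteq> F \<and> length u = Suc n. f u) = (\<Sum>a\<in>F. \<Sum>u | set u \<subseteq> F \<and> length u = n. f (a # u))"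
proof -
  have "(\<Sum>u | set u \<subseteq> F \<and> length u = Suc n. f u) =
      (\<Sum>(a, u)\<in>F \<times> {u. set u \<subseteq> F \<and> length u = n}. f (a # u))"
    by (rule sum.reindex_bij_witness[where i = "\<lambda>(a, u). a # u" and j = "\<lambda>u. (hd u, tl u)"])
      (auto simp: length_Suc_conv)
  then show ?thesis by (simp add: sum.cartesian_product)
qed

text \<open>Induction on the length by superharmonicity. The constant serves the empty word: on
  \<open>states m\<close> at most \<open>m * m\<close> steps lead to the hub, so the right-hand side
  is at least 1.\<close>

lemma sum_word_weight_le:
  assumes "a \<in> states m"
  shows "(\<Sum>u | set u \<subseteq> states m \<and> length u = n. word_weight (a # u)) \<le> 4 ^ (m * m) * (1/4) ^ steps a"
  using assms
proof (induction n arbitrary: a)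
  case 0
  have "{u. set u \<subseteq> states m \<and> length u = 0} = {[]}" by auto
  moreover have "(1/4::real) ^ (m * m) \<le> (1/4) ^ steps a"
    using steps_less[OF 0] by (intro power_decreasing) auto
  then have "(1::real) \<le> 4 ^ (m * m) * (1/4) ^ steps a" by (simp add: power_divide field_simps)
  ultimately show ?case by simp
next
  case (Suc n)
  have "(\<Sum>u | set u \<subseteq> states m \<and> length u = Suc n. word_weight (a # u)) =
      (\<Sum>b\<in>states m. (if edge a b then out_weight a else 0) *
        (\<Sum>u | set u \<subseteq> states m \<and> length u = n. word_weight (b # u)))"
    by (simp add: sum_lists_Suc sum_distrib_left)
  also have "\<dots> \<le> (\<Sum>b\<in>states m. (if edge a b then out_weight a else 0) * (4 ^ (m * m) * (1/4) ^ steps b))"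
    by (intro sum_mono mult_left_mono Suc.IH) auto
  also have "\<dots> = 4 ^ (m * m) * (out_weight a * (\<Sum>b\<in>{b \<in> states m. edge a b}. (1/4) ^ steps b))"
    by (simp add: sum_distrib_left sum.inter_filter if_distrib if_distribR cong: if_cong)
      (auto intro!: sum.cong simp: mult_ac)
  also have "\<dots> \<le> 4 ^ (m * m) * (1/4) ^ steps a"
    by (intro mult_left_mono sum_successors_le Suc.prems) auto
  finally show ?case .
qed

text \<open>The bound is independent of \<open>n\<close>, so normalising by it costs nothing in the
  entropy rate.\<close>

lemma total_word_weight_le:
  "(\<Sum>u | set u \<subseteq> states m \<and> length u = Suc n. word_weight u) \<le> 4 ^ (m * m) * real (card (states m))"
proof -
  have "(\<Sum>u | set u \<subseteq> states m \<and> length u = Suc n. word_weight u) \<le> (\<Sum>a\<in>states m. 4 ^ (m * m) * 1)"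
    unfolding sum_lists_Suc
  proof (rule sum_mono)
    fix a assume "a \<in> states m"
    then have "(\<Sum>u | set u \<subseteq> states m \<and> length u = n. word_weight (a # u)) \<le> 4 ^ (m * m) * (1/4) ^ steps a"
      by (rule sum_word_weight_le)
    also have "\<dots> \<le> 4 ^ (m * m) * 1" by (intro mult_left_mono power_le_one) auto
    finally show "(\<Sum>u | set u \<subseteq> states m \<and> length u = n. word_weight (a # u)) \<le> 4 ^ (m * m) * 1" .
  qed
  then show ?thesis by (simp add: mult.commute)
qed

subsection \<open>Approximation by cylinders\<close>

text \<open>The unions of equivalence classes of \<open>agree m\<close>. They are open, and so are
  their complements.\<close>

definition cylinder :: "nat \<Rightarrow> (nat \<Rightarrow> real) set \<Rightarrow> bool" where
  "cylinder m B \<longleftrightarrow> B \<subseteq> loop_space \<and>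
     (\<forall>x y. walk x \<longrightarrow> walk y \<longrightarrow> agree m x y \<longrightarrow> emb x \<in> B \<longrightarrow> emb y \<in> B)"

definition hub :: "(nat \<Rightarrow> real) set" where
  "hub = {emb x |x. walk x \<and> x 0 = 0}"

definition approximable :: "(nat \<Rightarrow> real) measure \<Rightarrow> (nat \<Rightarrow> real) set \<Rightarrow> bool" where
  "approximable \<mu> A \<longleftrightarrow> A \<in> sets \<mu> \<and> (\<forall>e>0. \<exists>m B. cylinder m B \<and> measure \<mu> ((A - B) \<union> (B - A)) < e)"

lemma cylinder_mono: "cylinder m B \<Longrightarrow> m \<le> n \<Longrightarrow> cylinder n B"
  unfolding cylinder_def using mono_agree by blast

lemma cylinderD: "cylinder m B \<Longrightarrow> walk x \<Longrightarrow> walk y \<Longrightarrow> agree m x y \<Longrightarrow> emb x \<in> B \<longleftrightarrow> emb y \<in> B"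
  unfolding cylinder_def using agree_sym by metis

lemma cylinder_Un:
  assumes "cylinder m B" "cylinder n C"
  shows "cylinder (max m n) (B \<union> C)"
proof -
  have B: "cylinder (max m n) B" and C: "cylinder (max m n) C"
    using assms by (auto intro: cylinder_mono)
  show ?thesis unfolding cylinder_def
  proof (intro conjI allI impI)
    show "B \<union> C \<subseteq> loop_space" using B C by (simp add: cylinder_def)
    fix x y assume "walk x" "walk y" "agree (max m n) x y" "emb x \<in> B \<union> C"
    then show "emb y \<in> B \<union> C" using cylinderD[OF B, of x y] cylinderD[OF C, of x y] by simp
  qed
qed

lemma cylinder_Diff:
  assumes "cylinder m B"
  shows "cylinder m (loop_space - B)"
  unfolding cylinder_def
proof (intro conjI allI impI)
  fix x y assume "walk x" "walk y" "agree m x y" "emb x \<in> loop_space - B"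
  then show "emb y \<in> loop_space - B" using cylinderD[OF assms, of x y] by simp
qed simp

lemma cylinder_open: "cylinder m B \<Longrightarrow> openin (mtopology_of loop_metric) B"
  unfolding openin_loop_space_iff cylinder_def by (metis emb_in_loop_space subsetD)

lemma borel_loops:
  assumes "borel_prob_on loop_metric \<mu>"
  shows "prob_space \<mu>" "space \<mu> = loop_space"
    "sets \<mu> = sigma_sets loop_space {U. openin (mtopology_of loop_metric) U}"
    "openin (mtopology_of loop_metric) U \<Longrightarrow> U \<in> sets \<mu>"
  using assms by (auto simp: borel_prob_on_def)

text \<open>The hub set is closed without being a cylinder, since walks on long loops agree with
  walks at the hub. Its complement is open: a state off the hub is fixed by a large truncation, and
  then no agreeing walk starts at the hub.\<close>

lemma hub_sets:
  assumes "borel_prob_on loop_metric \<mu>"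
  shows "hub \<in> sets \<mu>"
proof -
  have hub: "emb x \<in> hub \<longleftrightarrow> walk x \<and> x 0 = 0" for x by (auto simp: hub_def)
  have "\<exists>m. \<forall>y. walk y \<and> agree m x y \<longrightarrow> emb y \<in> loop_space - hub" if "emb x \<in> loop_space - hub" for x
  proof -
    have x: "walk x" "x 0 \<noteq> 0" using that hub by auto
    obtain m where "x 0 \<in> states m" using walk_states[OF x(1)] .
    then have "trunc (Suc m) (x 0) = x 0" using states_mono[of m "Suc m"] by (auto simp: trunc_def)
    then have "y 0 \<noteq> 0" if "agree (Suc m) x y" for y
    proof -
      have "trunc (Suc m) (y 0) = x 0"
        using that \<open>trunc (Suc m) (x 0) = x 0\<close> by (simp add: agree_def)
      then show ?thesis using x(2) by (metis trunc_0)
    qed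
    then show ?thesis using hub by (intro exI[of _ "Suc m"]) auto
  qed
  then have "openin (mtopology_of loop_metric) (loop_space - hub)"
    unfolding openin_loop_space_iff by (intro conjI Diff_subset allI impI)
  then have "space \<mu> - (loop_space - hub) \<in> sets \<mu>"
    using borel_loops(4)[OF assms] by (intro sets.compl_sets)
  moreover have "space \<mu> - (loop_space - hub) = hub"
  proof -
    have "hub \<subseteq> loop_space" by (auto simp: hub_def)
    then show ?thesis using borel_loops(2)[OF assms] by (simp add: double_diff)
  qed
  ultimately show ?thesis by simp
qed

lemma approximable_Un:
  assumes \<mu>: "borel_prob_on loop_metric \<mu>" and "approximable \<mu> A" "approximable \<mu> A'"
  shows "approximable \<mu> (A \<union> A')"
  unfolding approximable_def
proof (intro conjI allI impI)
  interpret prob_space \<mu> using borel_loops[OF \<mu>] by simp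
  have sets: "A \<in> sets \<mu>" "A' \<in> sets \<mu>" using assms by (auto simp: approximable_def)
  then show "A \<union> A' \<in> sets \<mu>" by blast
  fix e :: real assume "0 < e"
  then have "0 < e / 2" by simp
  then obtain m B m' B' where B: "cylinder m B" "measure \<mu> ((A - B) \<union> (B - A)) < e / 2"
    "cylinder m' B'" "measure \<mu> ((A' - B') \<union> (B' - A')) < e / 2"
    using assms(2,3) unfolding approximable_def by meson
  have Bs: "B \<in> sets \<mu>" "B' \<in> sets \<mu>" using B borel_loops(4)[OF \<mu>] cylinder_open by auto
  have "measure \<mu> ((A \<union> A' - (B \<union> B')) \<union> (B \<union> B' - (A \<union> A')))
      \<le> measure \<mu> (((A - B) \<union> (B - A)) \<union> ((A' - B') \<union> (B' - A')))"
    using sets Bs by (intro finite_measure_mono) auto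
  also have "\<dots> \<le> measure \<mu> ((A - B) \<union> (B - A)) + measure \<mu> ((A' - B') \<union> (B' - A'))"
    using sets Bs by (intro measure_Un_le) auto
  also have "\<dots> < e" using B by simp
  finally show "\<exists>m C. cylinder m C \<and> measure \<mu> ((A \<union> A' - C) \<union> (C - (A \<union> A'))) < e"
    using cylinder_Un[OF B(1,3)] by blast
qed

lemma approximable_incseq:
  assumes \<mu>: "borel_prob_on loop_metric \<mu>" and inc: "incseq A" and A: "\<And>n. approximable \<mu> (A n)"
  shows "approximable \<mu> (\<Union>n. A n)"
  unfolding approximable_def
proof (intro conjI allI impI)
  interpret prob_space \<mu> using borel_loops[OF \<mu>] by simp
  have sets: "A n \<in> sets \<mu>" for n using A by (simp add: approximable_def)
  show U: "(\<Union>n. A n) \<in> sets \<mu>" using sets by blast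
  fix e :: real assume "0 < e"
  have "(\<lambda>n. measure \<mu> (A n)) \<longlonglongrightarrow> measure \<mu> (\<Union>n. A n)"
    using sets inc by (intro finite_Lim_measure_incseq) auto
  then obtain n where "dist (measure \<mu> (A n)) (measure \<mu> (\<Union>n. A n)) < e / 2"
    using \<open>0 < e\<close> unfolding lim_sequentially by (metis half_gt_zero order_refl)
  moreover have "measure \<mu> ((\<Union>n. A n) - A n) = measure \<mu> (\<Union>n. A n) - measure \<mu> (A n)"
    using sets U by (intro finite_measure_Diff) auto
  ultimately have n: "measure \<mu> ((\<Union>n. A n) - A n) < e / 2"
    unfolding dist_real_def by linarith
  obtain m B where B: "cylinder m B" "measure \<mu> ((A n - B) \<union> (B - A n)) < e / 2"
    using A[of n] \<open>0 < e\<close> unfolding approximable_def by (meson half_gt_zero)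
  have Bs: "B \<in> sets \<mu>" using B borel_loops(4)[OF \<mu>] cylinder_open by auto
  have "measure \<mu> (((\<Union>n. A n) - B) \<union> (B - (\<Union>n. A n)))
      \<le> measure \<mu> (((\<Union>n. A n) - A n) \<union> ((A n - B) \<union> (B - A n)))"
    using sets U Bs by (intro finite_measure_mono) auto
  also have "\<dots> \<le> measure \<mu> ((\<Union>n. A n) - A n) + measure \<mu> ((A n - B) \<union> (B - A n))"
    using sets U Bs by (intro measure_Un_le) auto
  also have "\<dots> < e" using B n by simp
  finally show "\<exists>m C. cylinder m C \<and> measure \<mu> (((\<Union>n. A n) - C) \<union> (C - (\<Union>n. A n))) < e"
    using B(1) by blast
qed

lemma cylinder_approximable:
  assumes "borel_prob_on loop_metric \<mu>" "cylinder m B"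
  shows "approximable \<mu> B"
  unfolding approximable_def using borel_loops(4)[OF assms(1)] cylinder_open[OF assms(2)] assms(2)
  by (auto intro!: exI[of _ m] exI[of _ B])

lemma open_approximable:
  assumes \<mu>: "borel_prob_on loop_metric \<mu>" and U: "openin (mtopology_of loop_metric) U"
  shows "approximable \<mu> U"
proof -
  \<comment> \<open>The largest subset of \<open>U\<close> that is a cylinder of level
    \<open>m\<close>. These sets increase to \<open>U\<close>.\<close>
  define V where "V m = {emb x |x. walk x \<and> (\<forall>y. walk y \<and> agree m x y \<longrightarrow> emb y \<in> U)}" for m
  have V: "emb x \<in> V m \<longleftrightarrow> walk x \<and> (\<forall>y. walk y \<and> agree m x y \<longrightarrow> emb y \<in> U)" for x m
    by (auto simp: V_def)
  have "cylinder m (V m)" for m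
    unfolding cylinder_def V using agree_trans by (auto simp: V_def)
  moreover have "incseq V"
    unfolding incseq_def V_def using mono_agree by blast
  moreover have "(\<Union>m. V m) = U"
  proof (intro equalityI subsetI)
    fix z assume "z \<in> (\<Union>m. V m)"
    then show "z \<in> U" unfolding V_def using agree_refl by blast
  next
    fix z assume "z \<in> U"
    moreover from this obtain x where x: "walk x" "z = emb x"
      using U unfolding openin_loop_space_iff by (meson loop_spaceE subsetD)
    ultimately have "\<exists>m. \<forall>y. walk y \<and> agree m x y \<longrightarrow> emb y \<in> U"
      using U unfolding openin_loop_space_iff by blast
    then show "z \<in> (\<Union>m. V m)" using x by (auto simp: V)
  qed
  ultimately show ?thesis using approximable_incseq[OF \<mu>] cylinder_approximable[OF \<mu>] by metis
qed

lemma sets_approximable: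
  assumes \<mu>: "borel_prob_on loop_metric \<mu>" and "A \<in> sets \<mu>"
  shows "approximable \<mu> A"
proof -
  have "A \<in> sigma_sets loop_space {U. openin (mtopology_of loop_metric) U}"
    using assms borel_loops(3) by blast
  then show ?thesis
  proof induction
    case (Basic U)
    then show ?case using open_approximable[OF \<mu>] by simp
  next
    case Empty
    show ?case using open_approximable[OF \<mu> openin_empty] .
  next
    case (Compl A)
    have sub: "A \<subseteq> loop_space"
      using Compl.IH sets.sets_into_space borel_loops(2)[OF \<mu>] by (metis approximable_def)
    show ?case unfolding approximable_def
    proof (intro conjI allI impI)
      show "loop_space - A \<in> sets \<mu>"
        using Compl.IH borel_loops(2)[OF \<mu>] by (metis approximable_def sets.compl_sets)
      fix e :: real assume "0 < e"
      then obtain m B where B: "cylinder m B" "measure \<mu> ((A - B) \<union> (B - A)) < e"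
        using Compl.IH unfolding approximable_def by meson
      have "(loop_space - A - (loop_space - B)) \<union> (loop_space - B - (loop_space - A)) = (A - B) \<union> (B - A)"
        using sub B(1) by (auto simp: cylinder_def)
      then show "\<exists>m C. cylinder m C \<and> measure \<mu> ((loop_space - A - C) \<union> (C - (loop_space - A))) < e"
        using B cylinder_Diff[OF B(1)] by metis
    qed
  next
    case (Union A)
    \<comment> \<open>A countable union is the increasing limit of finite unions, so closure under
      binary unions and increasing limits is enough.\<close>
    have "approximable \<mu> (\<Union>i<n. A i)" for n :: nat
    proof (induction n)
      case 0
      then show ?case using open_approximable[OF \<mu> openin_empty] by simp
    next
      case (Suc n)
      then show ?case using approximable_Un[OF \<mu>] Union.IH by (simp add: lessThan_Suc)
    qed
    moreover have "incseq (\<lambda>n. \<Union>i<n. A i)" by (intro monoI UN_mono) auto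
    moreover have "(\<Union>n. \<Union>i<n. A i) = (\<Union>i. A i)" by auto
    ultimately show ?case using approximable_incseq[OF \<mu>, of "\<lambda>n. \<Union>i<n. A i"] by simp
  qed
qed

text \<open>Every walk visits the hub, so the preimages of \<open>hub\<close> under all iterates
  cover the space. By invariance they have equal measure, and countably many null sets cannot
  cover.\<close>

lemma hub_positive:
  assumes \<mu>: "borel_prob_on loop_metric \<mu>" and inv: "invariant_measure shift \<mu>"
  shows "0 < measure \<mu> hub"
proof (rule ccontr)
  interpret prob_space \<mu> using borel_loops[OF \<mu>] by simp
  note sp = borel_loops(2)[OF \<mu>]
  assume "\<not> ?thesis"
  then have 0: "measure \<mu> hub = 0" using measure_nonneg[of \<mu> hub] by linarith
  let ?H = "\<lambda>n. (shift ^^ n) -` hub \<inter> space \<mu>"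
  have H: "?H n \<in> sets \<mu>" "measure \<mu> (?H n) = 0" for n
    using measure_funpow_vimage[OF inv hub_sets[OF \<mu>], of n] 0 by auto
  have "?H n \<in> null_sets \<mu>" for n
    using H[of n] by (simp add: null_sets_def emeasure_eq_measure)
  then have "(\<Union>n. ?H n) \<in> null_sets \<mu>" by (rule null_sets_UN)
  moreover have "(\<Union>n. ?H n) = space \<mu>"
  proof -
    have "\<exists>n. (shift ^^ n) y \<in> hub" if y: "y \<in> loop_space" for y
    proof -
      obtain x where x: "walk x" "y = emb x" using y by (rule loop_spaceE)
      obtain n where "x n = 0" using walk_hits_0[OF x(1)] by blast
      then show ?thesis using walk_shift[OF x(1), of n]
        by (intro exI[of _ n]) (auto simp: x funpow_shift_emb hub_def)
    qed
    then show ?thesis using sp by blast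
  qed
  ultimately show False using emeasure_space_1 by (simp add: null_sets_def)
qed

text \<open>Used to discard the factors of the last \<open>m\<close> steps of a word, which are
  present only for the sake of the guesses, at a cost independent of \<open>n\<close>.\<close>

lemma prod_lessThan_add_ge:
  fixes f :: "nat \<Rightarrow> real"
  assumes "0 \<le> c" "\<And>i. c \<le> f i"
  shows "(\<Prod>i<n. f i) * c ^ k \<le> (\<Prod>i<n + k. f i)"
proof (induction k)
  case (Suc k)
  have "0 \<le> f i" for i using assms order_trans by blast
  then have "(\<Prod>i<n. f i) * c ^ k * c \<le> (\<Prod>i<n + k. f i) * f (n + k)"
    using assms Suc by (intro mult_mono prod_nonneg) auto
  then show ?case by (simp add: mult_ac)
qed simp

subsection \<open>An upper bound for the entropy of invariant measures\<close>

text \<open>A cylinder-measurable \<open>guess\<close> of the atom of \<open>P\<close>, wrong only on \<open>M\<close>, replaces conditional entropies: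
  an itinerary through \<open>P\<close> gets the weight of a word times, for each time, a factor \<open>1 - \<eta>\<close> if the
  guess is right and \<open>\<eta> / card P\<close> if it is wrong.\<close>

lemma partition_entropy_iterated_join_le:
  fixes guess :: "(nat \<Rightarrow> nat) \<Rightarrow> (nat \<Rightarrow> real) set"
  assumes \<mu>: "borel_prob_on loop_metric \<mu>" and inv: "invariant_measure shift \<mu>"
    and P: "finite_meas_partition \<mu> P" and \<eta>: "0 < \<eta>" "\<eta> \<le> 1/2"
    and guess: "\<And>x. guess x \<in> P" "\<And>x y. walk x \<Longrightarrow> walk y \<Longrightarrow> agree m x y \<Longrightarrow> guess x = guess y"
    and M: "M \<in> sets \<mu>" "\<And>x. walk x \<Longrightarrow> emb x \<notin> M \<Longrightarrow> emb x \<in> guess x"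
  shows "partition_entropy \<mu> (iterated_join loop_space shift P n) \<le>
    ln (4 ^ (m * m) * real (card (states m))) + real m * ln 4 +
    real n * (ln 4 - ln 2 * measure \<mu> hub - ln (1 - \<eta>) + ln (real (card P) / \<eta>) * measure \<mu> M)"
proof -
  interpret prob_space \<mu> using borel_loops[OF \<mu>] by simp
  have sp: "space \<mu> = loop_space" by (rule borel_loops[OF \<mu>])
  have ne: "loop_space \<noteq> {}" using emb_in_loop_space[of "\<lambda>_. 0"] walk_const_0 by blast
  have shift: "shift \<in> measurable \<mu> \<mu>" using inv by (simp add: invariant_measure_def)
  have P': "finite P" "P \<subseteq> sets \<mu>" "partition_on loop_space P"
    using P sp by (auto simp: finite_meas_partition_def)
  have card_P: "1 \<le> real (card P)" using P'(1) guess(1) by (simp add: Suc_le_eq card_gt_0_iff) blast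
  define \<beta> where "\<beta> = ln (real (card P) / \<eta>)"
  have "1 \<le> real (card P) / \<eta>" using card_P \<eta> by (simp add: field_simps)
  then have \<beta>: "0 \<le> \<beta>" by (simp add: \<beta>_def)
  define R where "R = iterated_join loop_space shift P n"
  have "shift \<in> loop_space \<rightarrow> loop_space" using shift_loop_space by (rule Pi_I)
  then have R: "finite R" "R \<subseteq> sets \<mu>" "partition_on loop_space R"
    unfolding R_def using finite_iterated_join[OF P'(1)] iterated_join_sets[OF P'(2) shift, of n]
      partition_on_iterated_join[OF P'(3) ne] by (simp_all only: sp)
  have "\<forall>A\<in>R. \<exists>l. l \<in> PiE {..<n} (\<lambda>_. P) \<and> A = {x \<in> loop_space. \<forall>i<n. (shift ^^ i) x \<in> l i}"
  proof
    fix A assume A: "A \<in> R"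
    obtain l where "l \<in> PiE {..<n} (\<lambda>_. P)" "A = {x \<in> loop_space. \<forall>i<n. (shift ^^ i) x \<in> l i}"
      using iterated_join_cylinder[OF ne A[unfolded R_def]] by (elim conjE bexE)
    then show "\<exists>l. l \<in> PiE {..<n} (\<lambda>_. P) \<and> A = {x \<in> loop_space. \<forall>i<n. (shift ^^ i) x \<in> l i}"
      by (intro exI conjI)
  qed
  from bchoice[OF this] obtain L where L_all:
    "\<forall>A\<in>R. L A \<in> PiE {..<n} (\<lambda>_. P) \<and> A = {x \<in> loop_space. \<forall>i<n. (shift ^^ i) x \<in> L A i}" ..
  have L: "L A \<in> PiE {..<n} (\<lambda>_. P)" "A = {x \<in> loop_space. \<forall>i<n. (shift ^^ i) x \<in> L A i}"
    if "A \<in> R" for A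
    by (rule conjunct1[OF bspec[OF L_all that]], rule conjunct2[OF bspec[OF L_all that]])
  have inj_L: "inj_on L R"
  proof (rule inj_onI)
    fix A B assume "A \<in> R" "B \<in> R" and eq: "L A = L B"
    have "A = {x \<in> loop_space. \<forall>i<n. (shift ^^ i) x \<in> L A i}" by (rule L(2)) fact
    also have "\<dots> = B" unfolding eq by (rule L(2)[symmetric]) fact
    finally show "A = B" .
  qed
  \<comment> \<open>The guess at a time \<open>i < n\<close> reads the \<open>m\<close> letters from
    position \<open>i\<close> on. One more letter makes the word weight a product of exactly
    \<open>n + m\<close> factors.\<close>
  define W where "W = {u. set u \<subseteq> states m \<and> length u = Suc (n + m)}"
  have [simp]: "finite W" unfolding W_def by (intro finite_lists_length_eq) simp
  define D where "D = 4 ^ (m * m) * real (card (states m))"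
  have "0 < card (states m)" unfolding card_gt_0_iff using zero_in_states finite_states by blast
  then have D: "0 < D" by (simp add: D_def)
  define word where "word x k = map (\<lambda>i. trunc m (x i)) [0..<k]" for x k
  \<comment> \<open>The guess depends only on the first \<open>m\<close> truncated letters, hence
    descends to words; any walk with the given word may be used.\<close>
  define g where "g u = guess (SOME x. walk x \<and> word x m = u)" for u
  have g_word: "g (word x m) = guess x" if x: "walk x" for x
  proof -
    define y where "y = (SOME y. walk y \<and> word y m = word x m)"
    have y: "walk y \<and> word y m = word x m" unfolding y_def by (rule someI[of _ x]) (simp add: x)
    then have "agree m y x" by (auto simp: agree_def word_def)
    then show ?thesis using guess(2)[of y x] x y by (simp add: g_def flip: y_def)
  qed
  define \<kappa> where "\<kappa> u i B = (if B = g (take m (drop i u)) then 1 - \<eta> else \<eta> / real (card P))" for u i B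
  have \<kappa>_pos: "0 < \<kappa> u i B" for u i B using \<eta> card_P by (simp add: \<kappa>_def)
  have \<kappa>_sum: "(\<Sum>B\<in>P. \<kappa> u i B) \<le> 1" for u i
  proof -
    have "(\<Sum>B\<in>P. \<kappa> u i B) \<le> (\<Sum>B\<in>P. (if B = g (take m (drop i u)) then 1 - \<eta> else 0) + \<eta> / real (card P))"
      using \<eta> by (intro sum_mono) (auto simp: \<kappa>_def)
    also have "\<dots> \<le> 1" using P'(1) \<eta> card_P by (simp add: sum.distrib sum.delta)
    finally show ?thesis .
  qed
  \<comment> \<open>A mixture over all words. Summing over the atoms first gives at most 1 for each
    word, and the word weights then add up to at most \<open>D\<close>.\<close>
  define w where "w A = (\<Sum>u\<in>W. word_weight u * (\<Prod>i<n. \<kappa> u i (L A i))) / D" for A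
  have "sum w R = (\<Sum>u\<in>W. word_weight u * (\<Sum>A\<in>R. \<Prod>i<n. \<kappa> u i (L A i))) / D"
    unfolding w_def sum_distrib_left sum_divide_distrib[symmetric] by (subst sum.swap) simp
  also have "\<dots> \<le> (\<Sum>u\<in>W. word_weight u * 1) / D"
    using D P'(1) inj_L L(1) \<kappa>_pos \<kappa>_sum
    by (intro divide_right_mono sum_mono mult_left_mono word_weight_nonneg sum_prod_kernel_le_1)
      (auto intro: less_imp_le)
  also have "\<dots> \<le> 1"
    using total_word_weight_le[of m "n + m"] D unfolding W_def D_def by simp
  finally have sum_w: "sum w R \<le> 1" .
  define h where "h i y = ln 4 - ln (1 - \<eta>) - ln 2 * indicator ((shift ^^ i) -` hub \<inter> space \<mu>) y
      + \<beta> * indicator ((shift ^^ i) -` M \<inter> space \<mu>) y" for i y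
  have key: "0 < w A \<and> - ln (w A) \<le> ln D + real m * ln 4 + (\<Sum>i<n. h i y)" if A: "A \<in> R" "y \<in> A" for A y
  proof -
    have "y \<in> loop_space" using L(2)[OF A(1)] A(2) by blast
    then obtain x where x: "walk x" "y = emb x" by (rule loop_spaceE)
    define u where "u = word x (Suc (n + m))"
    have u: "u \<in> W" by (auto simp: u_def word_def W_def)
    define q where "q i = out_weight (x i) * \<kappa> u i (L A i)" for i
    have q: "0 < q i" for i using \<kappa>_pos by (simp add: q_def)
    \<comment> \<open>To bound \<open>w A\<close> from below, only the word of the point
      \<open>y\<close> is kept. Truncation can send a state to the hub but never away from it, so it
      only increases the weights.\<close>
    have "(\<Prod>i<n. out_weight (x i)) * (1/4) ^ m \<le> (\<Prod>i<n. out_weight (trunc m (x i))) * (1/4) ^ m"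
      by (intro mult_right_mono prod_mono) (auto simp: out_weight_def)
    also have "\<dots> \<le> (\<Prod>i<n + m. out_weight (trunc m (x i)))"
      by (intro prod_lessThan_add_ge) (auto simp: out_weight_def)
    also have "\<dots> = word_weight u"
      unfolding u_def word_def using word_weight_walk[OF walk_trunc[OF x(1)]] by simp
    finally have "(\<Prod>i<n. out_weight (x i)) * (1/4) ^ m * (\<Prod>i<n. \<kappa> u i (L A i)) / D
        \<le> word_weight u * (\<Prod>i<n. \<kappa> u i (L A i)) / D"
      using D \<kappa>_pos by (intro divide_right_mono mult_right_mono prod_nonneg) (auto intro: less_imp_le)
    moreover have "(\<Prod>i<n. out_weight (x i)) * (1/4) ^ m * (\<Prod>i<n. \<kappa> u i (L A i)) = (\<Prod>i<n. q i) * (1/4) ^ m"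
      by (simp add: q_def prod.distrib)
    ultimately have "(\<Prod>i<n. q i) * (1/4) ^ m / D \<le> word_weight u * (\<Prod>i<n. \<kappa> u i (L A i)) / D"
      by (simp only:)
    also have "\<dots> \<le> w A"
      unfolding w_def using u D \<kappa>_pos
      by (intro divide_right_mono member_le_sum mult_nonneg_nonneg word_weight_nonneg prod_nonneg)
        (auto intro: less_imp_le)
    finally have le: "(\<Prod>i<n. q i) * (1/4) ^ m / D \<le> w A" .
    moreover have pos: "0 < (\<Prod>i<n. q i) * (1/4) ^ m / D" using q D by (simp add: prod_pos)
    ultimately have "- ln (w A) \<le> - ln ((\<Prod>i<n. q i) * (1/4) ^ m / D)" by simp
    also have "\<dots> = ln D + real m * ln 4 - (\<Sum>i<n. ln (q i))"
      using q D by (simp add: ln_div ln_mult ln_realpow ln_prod prod_pos less_imp_neq[symmetric])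
    finally have ln_w: "- ln (w A) \<le> ln D + real m * ln 4 - (\<Sum>i<n. ln (q i))" .
    have "- (\<Sum>i<n. ln (q i)) \<le> (\<Sum>i<n. h i y)"
      unfolding sum_negf[symmetric]
    proof (rule sum_mono)
      fix i assume "i \<in> {..<n}"
      then have i: "i < n" by simp
      define z where "z = (\<lambda>j. x (j + i))"
      have z: "walk z" "(shift ^^ i) y = emb z"
        using walk_shift[OF x(1), of i] by (auto simp: z_def x funpow_shift_emb)
      have "take m (drop i u) = word z m"
        using i unfolding u_def word_def z_def
        by (intro nth_equalityI) (auto simp del: upt_Suc simp: add.commute)
      then have gz: "g (take m (drop i u)) = guess z" using g_word[OF z(1)] by simp
      have yS: "y \<in> space \<mu>" using \<open>y \<in> loop_space\<close> sp by simp
      have "- ln (\<kappa> u i (L A i)) \<le> - ln (1 - \<eta>) + \<beta> * indicator ((shift ^^ i) -` M \<inter> space \<mu>) y"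
      proof (cases "emb z \<in> M")
        case False
        have "y \<in> {x \<in> loop_space. \<forall>i<n. (shift ^^ i) x \<in> L A i}"
          by (subst L(2)[OF A(1), symmetric]) (rule A(2))
        then have "(shift ^^ i) y \<in> L A i" using i by blast
        then have "emb z \<in> L A i" unfolding z(2) .
        moreover have "emb z \<in> guess z" using M(2)[OF z(1) False] .
        moreover have "L A i \<in> P" "guess z \<in> P" using L(1)[OF A(1)] i guess(1) by auto
        ultimately have "L A i = guess z" using P'(3) by (auto simp: partition_on_def disjoint_def)
        then show ?thesis using gz \<beta> by (simp add: \<kappa>_def)
      next
        \<comment> \<open>On \<open>M\<close> the guess may be right or wrong; the bound covers
          both, as \<open>- ln (1 - \<eta>)\<close> and \<open>\<beta>\<close> are
          nonnegative.\<close>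
        case True
        have 1: "0 \<le> - ln (1 - \<eta>)" using \<eta> by simp
        have "ln (\<eta> / real (card P)) = - \<beta>" using \<eta> card_P by (simp add: \<beta>_def ln_div)
        then have "- ln (\<kappa> u i (L A i)) \<le> - ln (1 - \<eta>) + \<beta>"
          using 1 \<beta> by (simp add: \<kappa>_def)
        then show ?thesis using True z(2) yS by simp
      qed
      moreover have "- ln (out_weight (x i)) = ln 4 - ln 2 * indicator ((shift ^^ i) -` hub \<inter> space \<mu>) y"
      proof -
        have "emb z \<in> hub \<longleftrightarrow> x i = 0" using z(1) by (auto simp: hub_def z_def)
        moreover have "ln (4::real) = 2 * ln 2" using ln_realpow[of 2 2] by simp
        ultimately show ?thesis using z(2) yS by (auto simp: out_weight_def ln_div)
      qed
      ultimately show "- ln (q i) \<le> h i y"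
        unfolding q_def h_def ln_mult_pos[OF out_weight_pos(1) \<kappa>_pos] by linarith
    qed
    then show ?thesis using ln_w le pos by simp
  qed
  \<comment> \<open>By invariance the integral of \<open>h i\<close> does not depend on
    \<open>i\<close>, which yields the factor \<open>n\<close> in the final estimate.\<close>
  have h: "integrable \<mu> (h i)" "(\<integral>y. h i y \<partial>\<mu>) = ln 4 - ln (1 - \<eta>) - ln 2 * measure \<mu> hub + \<beta> * measure \<mu> M" for i
  proof -
    note Z = measure_funpow_vimage[OF inv hub_sets[OF \<mu>], of i]
    note MM = measure_funpow_vimage[OF inv M(1), of i]
    have int: "integrable \<mu> (indicator ((shift ^^ i) -` hub \<inter> space \<mu>) :: _ \<Rightarrow> real)"
        "integrable \<mu> (indicator ((shift ^^ i) -` M \<inter> space \<mu>) :: _ \<Rightarrow> real)"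
      using Z(1) MM(1) by (auto intro!: integrable_real_indicator simp: emeasure_eq_measure)
    show "integrable \<mu> (h i)" unfolding h_def using int by (intro Bochner_Integration.integrable_add Bochner_Integration.integrable_diff integrable_mult_right) auto
    show "(\<integral>y. h i y \<partial>\<mu>) = ln 4 - ln (1 - \<eta>) - ln 2 * measure \<mu> hub + \<beta> * measure \<mu> M"
      unfolding h_def using int Z MM by (simp add: prob_space)
  qed
  have "partition_entropy \<mu> R \<le> (\<integral>y. ln D + real m * ln 4 + (\<Sum>i<n. h i y) \<partial>\<mu>)"
  proof (rule partition_entropy_le_integral[where w = w])
    show "0 < w A" if "A \<in> R" for A
    proof -
      have "A \<noteq> {}" using that R(3) by (auto simp: partition_on_def)
      then show ?thesis using key[OF that] by blast
    qed
    show "integrable \<mu> (\<lambda>y. ln D + real m * ln 4 + (\<Sum>i<n. h i y))"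
      using h(1) by (intro Bochner_Integration.integrable_add Bochner_Integration.integrable_sum) auto
  qed (use R sp sum_w key in \<open>auto intro: prob_space_axioms\<close>)
  also have "\<dots> = ln D + real m * ln 4 + real n * (ln 4 - ln (1 - \<eta>) - ln 2 * measure \<mu> hub + \<beta> * measure \<mu> M)"
    using h by (simp add: prob_space)
  finally show ?thesis unfolding R_def D_def \<beta>_def by (simp add: algebra_simps)
qed

text \<open>The two error terms of the preceding estimate are made at most
  \<open>\<gamma> / 2\<close> each. First \<open>\<eta>\<close> is fixed, which fixes the penalty
  \<open>\<beta>\<close> for a wrong guess; then the atoms are approximated by cylinders well enough
  to compensate for \<open>\<beta>\<close>.\<close>

lemma entropy_wrt_le:
  assumes \<mu>: "borel_prob_on loop_metric \<mu>" and inv: "invariant_measure shift \<mu>"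
    and P: "finite_meas_partition \<mu> P"
  shows "entropy_wrt \<mu> shift P \<le> ereal (ln 4 - ln 2 * measure \<mu> hub)"
proof (rule ereal_le_epsilon2)
  fix \<gamma> :: real assume \<gamma>: "0 < \<gamma>"
  interpret prob_space \<mu> using borel_loops[OF \<mu>] by simp
  have sp: "space \<mu> = loop_space" by (rule borel_loops[OF \<mu>])
  have P': "finite P" "P \<subseteq> sets \<mu>" "partition_on loop_space P"
    using P sp by (auto simp: finite_meas_partition_def)
  have "emb (\<lambda>_. 0) \<in> \<Union>P" using P'(3) walk_const_0 by (simp add: partition_on_def)
  then have "P \<noteq> {}" by blast
  then have card_P: "1 \<le> real (card P)" using P'(1) by (simp add: Suc_le_eq card_gt_0_iff)
  \<comment> \<open>Chosen so that \<open>- ln (1 - \<eta>) \<le> \<gamma> / 2\<close>.\<close>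
  define \<eta> where "\<eta> = min (1/2) (1 - exp (- (\<gamma> / 2)))"
  have \<eta>: "0 < \<eta>" "\<eta> \<le> 1/2" and "\<eta> \<le> 1 - exp (- (\<gamma> / 2))"
    using \<gamma> unfolding \<eta>_def by (simp, intro min.cobounded1, intro min.cobounded2)
  then have "exp (- (\<gamma> / 2)) \<le> 1 - \<eta>" by simp
  then have "ln (exp (- (\<gamma> / 2))) \<le> ln (1 - \<eta>)" by (subst ln_le_cancel_iff) (use \<eta> in auto)
  then have ln_\<eta>: "- ln (1 - \<eta>) \<le> \<gamma> / 2" by simp
  define \<beta> where "\<beta> = ln (real (card P) / \<eta>)"
  have "1 \<le> real (card P) / \<eta>" using card_P \<eta> by (simp add: field_simps)
  then have \<beta>: "0 \<le> \<beta>" by (simp add: \<beta>_def)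
  \<comment> \<open>Summed over the atoms these errors bound the measure of \<open>M\<close> by
    \<open>\<gamma> / (2 * (\<beta> + 1))\<close>, and \<open>\<beta>\<close> times this is at most
    \<open>\<gamma> / 2\<close>. The 1 prevents division by zero.\<close>
  define e where "e = \<gamma> / (2 * (\<beta> + 1)) / real (card P)"
  have e: "0 < e" using \<gamma> \<beta> card_P by (simp add: e_def)
  have "\<forall>A\<in>P. \<exists>mB. cylinder (fst mB) (snd mB) \<and> measure \<mu> ((A - snd mB) \<union> (snd mB - A)) < e"
  proof
    fix A assume "A \<in> P"
    then have "approximable \<mu> A" using P'(2) sets_approximable[OF \<mu>] by blast
    then obtain m B where "cylinder m B" "measure \<mu> ((A - B) \<union> (B - A)) < e"
      using e unfolding approximable_def by meson
    then show "\<exists>mB. cylinder (fst mB) (snd mB) \<and> measure \<mu> ((A - snd mB) \<union> (snd mB - A)) < e"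
      by (intro exI[of _ "(m, B)"]) simp
  qed
  from bchoice[OF this] obtain mB where mB:
    "\<forall>A\<in>P. cylinder (fst (mB A)) (snd (mB A)) \<and> measure \<mu> ((A - snd (mB A)) \<union> (snd (mB A) - A)) < e" ..
  define B where "B A = snd (mB A)" for A
  define m where "m = Max ((\<lambda>A. fst (mB A)) ` P)"
  have B: "cylinder m (B A)" "measure \<mu> ((A - B A) \<union> (B A - A)) < e" if A: "A \<in> P" for A
  proof -
    have "fst (mB A) \<le> m" unfolding m_def using P'(1) A by (intro Max_ge) auto
    then show "cylinder m (B A)" using mB A cylinder_mono unfolding B_def by blast
    show "measure \<mu> ((A - B A) \<union> (B A - A)) < e" using mB A unfolding B_def by blast
  qed
  have B_sets: "B A \<in> sets \<mu>" if "A \<in> P" for A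
    using borel_loops(4)[OF \<mu> cylinder_open[OF B(1)[OF that]]] .
  \<comment> \<open>Picks an atom whose approximating cylinder contains the point, if there is one.
    The choice depends only on which of the cylinders contain it, hence is constant on classes of
    \<open>agree m\<close>.\<close>
  define guess where "guess x = (SOME A. A \<in> P \<and> ((\<exists>C\<in>P. emb x \<in> B C) \<longrightarrow> emb x \<in> B A))" for x
  have guess: "guess x \<in> P \<and> ((\<exists>C\<in>P. emb x \<in> B C) \<longrightarrow> emb x \<in> B (guess x))" for x
    unfolding guess_def by (rule someI_ex) (use \<open>P \<noteq> {}\<close> in blast)
  have guess_agree: "guess x = guess y" if "walk x" "walk y" "agree m x y" for x y
  proof -
    have "emb x \<in> B A \<longleftrightarrow> emb y \<in> B A" if "A \<in> P" for A
      using cylinderD[OF B(1)[OF that] \<open>walk x\<close> \<open>walk y\<close> \<open>agree m x y\<close>] .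
    then have "(\<lambda>A. A \<in> P \<and> ((\<exists>C\<in>P. emb x \<in> B C) \<longrightarrow> emb x \<in> B A)) =
        (\<lambda>A. A \<in> P \<and> ((\<exists>C\<in>P. emb y \<in> B C) \<longrightarrow> emb y \<in> B A))" by blast
    then show ?thesis unfolding guess_def by simp
  qed
  \<comment> \<open>Off \<open>M\<close> each atom and its cylinder contain the same points, so the
    guessed atom is the true one.\<close>
  define M where "M = (\<Union>A\<in>P. (A - B A) \<union> (B A - A))"
  have M_sets: "M \<in> sets \<mu>" unfolding M_def using P' B_sets by (intro sets.finite_UN) auto
  have guess_M: "emb x \<in> guess x" if x: "walk x" "emb x \<notin> M" for x
  proof -
    have eq: "emb x \<in> A \<longleftrightarrow> emb x \<in> B A" if "A \<in> P" for A
      using x(2) that by (auto simp: M_def)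
    have "emb x \<in> \<Union>P" using x(1) P'(3) by (simp add: partition_on_def)
    then obtain A where "A \<in> P" "emb x \<in> A" by blast
    then have "\<exists>C\<in>P. emb x \<in> B C" using eq by blast
    then show ?thesis using guess[of x] eq by blast
  qed
  have "measure \<mu> M \<le> (\<Sum>A\<in>P. measure \<mu> ((A - B A) \<union> (B A - A)))"
    unfolding M_def using P' B_sets by (intro measure_UNION_le) auto
  also have "\<dots> \<le> (\<Sum>A\<in>P. e)" using B(2) by (intro sum_mono less_imp_le)
  also have "\<dots> = \<gamma> / (2 * (\<beta> + 1))" using card_P by (simp add: e_def)
  finally have "\<beta> * measure \<mu> M \<le> \<beta> * (\<gamma> / (2 * (\<beta> + 1)))" using \<beta> by (rule mult_left_mono)
  also have "\<dots> \<le> \<gamma> / 2" using \<beta> \<gamma> by (simp add: field_simps)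
  finally have \<beta>M: "\<beta> * measure \<mu> M \<le> \<gamma> / 2" .
  define K where "K = ln (4 ^ (m * m) * real (card (states m))) + real m * ln 4"
  define c where "c = ln 4 - ln 2 * measure \<mu> hub"
  have "partition_entropy \<mu> (iterated_join loop_space shift P n) / real n \<le> K / real n + (c + \<gamma>)"
    if n: "0 < n" for n
  proof -
    have "partition_entropy \<mu> (iterated_join loop_space shift P n) \<le>
        K + real n * (ln 4 - ln 2 * measure \<mu> hub - ln (1 - \<eta>) + \<beta> * measure \<mu> M)"
      unfolding K_def \<beta>_def
      by (rule partition_entropy_iterated_join_le[OF \<mu> inv P \<eta> conjunct1[OF guess] guess_agree M_sets guess_M])
    also have "\<dots> \<le> K + real n * (c + \<gamma>)"
      using ln_\<eta> \<beta>M unfolding c_def by (intro add_left_mono mult_left_mono) auto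
    finally show ?thesis using n by (simp add: field_simps)
  qed
  then have "entropy_wrt \<mu> shift P \<le> limsup (\<lambda>n. ereal (K / real n + (c + \<gamma>)))"
    unfolding entropy_wrt_def sp
    by (intro Limsup_mono eventually_mono[OF eventually_gt_at_top[of 0]]) simp
  also have "\<dots> = ereal (c + \<gamma>)"
  proof (rule lim_imp_Limsup)
    have "(\<lambda>n. K / real n + (c + \<gamma>)) \<longlonglongrightarrow> 0 + (c + \<gamma>)"
      by (intro tendsto_add tendsto_const lim_const_over_n)
    then show "(\<lambda>n. ereal (K / real n + (c + \<gamma>))) \<longlonglongrightarrow> ereal (c + \<gamma>)" by simp
  qed simp
  finally show "entropy_wrt \<mu> shift P \<le> ereal (ln 4 - ln 2 * measure \<mu> hub) + ereal \<gamma>"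
    by (simp add: c_def)
qed

lemma measure_entropy_less:
  assumes \<mu>: "borel_prob_on loop_metric \<mu>" and inv: "invariant_measure shift \<mu>"
  shows "measure_entropy \<mu> shift < ereal (ln 4)"
proof -
  have "measure_entropy \<mu> shift \<le> ereal (ln 4 - ln 2 * measure \<mu> hub)"
    unfolding measure_entropy_def using entropy_wrt_le[OF \<mu> inv] by (intro SUP_least) simp
  also have "\<dots> < ereal (ln 4)" using hub_positive[OF \<mu> inv] by simp
  finally show ?thesis .
qed

theorem theoremD:
  shows "\<exists>(m :: (nat \<Rightarrow> real) metric) T.
    dynamical_system m T \<and> transitive_system m T \<and> shadowing_property m T \<and>
    (\<forall>\<mu>. borel_prob_on m \<mu> \<and> invariant_measure T \<mu> \<longrightarrow> measure_entropy \<mu> T < top_entropy m T)"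
  using dynamical_system_loops transitive_loops shadowing_loops
    measure_entropy_less ln_4_le_top_entropy_loops
  by (meson order_less_le_trans)

end
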